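(* Let $f\not\equiv0$ be a meromorphic function on $\mathbb{C}$, let $\eta$ be a non-zero complex number, and let $\gamma>1$ and $\varepsilon>0$ be given real constants. Then there exists a subset $E\subset(1,\infty)$ of finite logarithmic measure such that: (a) there is a constant $A$ depending only on $\gamma$ and $\eta$ such that for all $z$ with $|z|=r\notin E\cup[0,1]$, $$\left|\log\left|\frac{f(z+\eta)}{f(z)}\right|\right|\le A\left(\frac{T(\gamma r,f)}{r}+\frac{n(\gamma r)}{r}\,\log^\gamma r\,\log^+ n(\gamma r)\right);$$ (b) if in addition $f$ has finite order $\sigma$, then for all $z$ with $|z|=r\notin E\cup[0,1]$, $$\exp\big(-r^{\sigma-1+\varepsilon}\big)\le\left|\frac{f(z+\eta)}{f(z)}\right|\le\exp\big(r^{\sigma-1+\varepsilon}\big).$$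
   Context: Meromorphic means meromorphic in the whole complex plane. $m(r,f)=\frac1{2\pi}\int_0^{2\pi}\log^+|f(re^{i\theta})|\,d\theta$; $n(t,f)$ is the number of poles of $f$ in $|z|\le t$, with multiplicity; $N(r,f)=\int_0^r\frac{n(t,f)-n(0,f)}{t}\,dt+n(0,f)\log r$; $T(r,f)=m(r,f)+N(r,f)$. The order of $f$ is $\limsup_{r\to\infty}\frac{\log^+T(r,f)}{\log r}$. The notation $n(t)$ means $n(t)=n(t,f)+n(t,1/f)$, and $\log^\gamma r=(\log r)^\gamma$. A set $E\subset(1,\infty)$ has finite logarithmic measure if $\int_E\frac{dt}{t}<\infty$. *)

theory Defs
  imports "HOL-Complex_Analysis.Complex_Analysis"
begin

(* Meromorphic functions on the plane are the functions that are nicely_meromorphic_on UNIV: their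
   removable singularities are removed and they take the value 0 at poles. Hence "f z \<noteq> 0" says
   that z is neither a zero nor a pole of f, and f is identically zero iff f = (\<lambda>_. 0). *)

text \<open>Used for nonnegative arguments only; as \<open>ln 0 = 0\<close>, the value at 0 is 0.\<close>
definition log_plus :: "real \<Rightarrow> real" where
  "log_plus x = max 0 (ln x)"

definition pole_count :: "real \<Rightarrow> (complex \<Rightarrow> complex) \<Rightarrow> nat" where
  "pole_count t f = (\<Sum>z | cmod z \<le> t \<and> is_pole f z. nat (- zorder f z))"

definition zero_pole_count :: "real \<Rightarrow> (complex \<Rightarrow> complex) \<Rightarrow> nat" where
  "zero_pole_count t f = pole_count t f + pole_count t (\<lambda>z. 1 / f z)"

definition proximity :: "real \<Rightarrow> (complex \<Rightarrow> complex) \<Rightarrow> real" where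
  "proximity r f =
     1 / (2 * pi) * integral {0..2 * pi} (\<lambda>\<theta>. log_plus (cmod (f (of_real r * exp (\<i> * of_real \<theta>)))))"

definition integrated_count :: "real \<Rightarrow> (complex \<Rightarrow> complex) \<Rightarrow> real" where
  "integrated_count r f =
     integral {0..r} (\<lambda>t. (real (pole_count t f) - real (pole_count 0 f)) / t)
     + real (pole_count 0 f) * ln r"

definition nevanlinna_T :: "real \<Rightarrow> (complex \<Rightarrow> complex) \<Rightarrow> real" where
  "nevanlinna_T r f = proximity r f + integrated_count r f"

definition growth_order :: "(complex \<Rightarrow> complex) \<Rightarrow> ereal" where
  "growth_order f = Limsup at_top (\<lambda>r::real. ereal (log_plus (nevanlinna_T r f) / ln r))"

definition finite_log_measure :: "real set \<Rightarrow> bool" where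
  "finite_log_measure E \<longleftrightarrow>
     E \<in> sets lebesgue \<and> (\<integral>\<^sup>+ t\<in>E. ennreal (1 / t) \<partial>lebesgue) < \<infinity>"

end

theory Submission
  imports Defs "HOL-Real_Asymp.Real_Asymp"
begin

text \<open>
  Let \<open>R = \<gamma> |z|\<close>. Dividing \<open>f\<close> by the Blaschke factors of its zeros and poles in \<open>|z| < R\<close> leaves
  the exponential of a holomorphic function \<open>h\<close> with \<open>Re h = log |f|\<close> on \<open>|z| = R\<close>. The Schwarz
  integral bounds \<open>|h (z + \<eta>) - h z|\<close> by \<open>O(1/R)\<close> times the mean of \<open>|log |f||\<close>, which Jensen's
  formula bounds by \<open>2 T(R, f) + O(1)\<close>. The Blaschke factors contribute \<open>O(n(R)/r)\<close> and the sum of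
  \<open>1 / |z - a| + 1 / |z + \<eta> - a|\<close> over the zeros and poles \<open>a\<close>. As only the modulus of \<open>z\<close> may be
  restricted, these terms are replaced by \<open>1 / |r - |a|| + 1 / |r - |a - \<eta>||\<close>, and a Markov
  inequality for the truncated sum on each annulus \<open>\<beta>^m \<le> r \<le> \<beta>^(m+1)\<close>, \<open>\<beta> = sqrt \<gamma>\<close>, makes it
  small outside a set of measure \<open>\<beta>^m / (m+1)^\<kappa>\<close> with \<open>1 < \<kappa> < \<gamma>\<close>: the loss of \<open>log m\<close> from the
  truncation is absorbed by \<open>log^(\<gamma> - \<kappa>) r\<close>.

  Moving the radii \<open>|a| / \<gamma>\<close> and \<open>|a| / \<gamma>^2\<close> into the exceptional set keeps the circles \<open>|z| = R\<close>
  and \<open>|z| = \<gamma> R\<close> free of zeros and poles, so that the monotonicity of \<open>T\<close> is never used.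
\<close>

section \<open>The Schwarz integral\<close>

text \<open>The constant \<open>A\<close> is fixed before \<open>f\<close>, so every constant that
  belongs to \<open>f\<close> has to disappear. Jensen's formula leaves an additive
  \<open>K\<close>; and if \<open>n(\<gamma> r) <= 1\<close>, the term with \<open>log_plus\<close>
  is 0 and cannot pay for the \<open>O(1/r)\<close> that a single zero or pole causes. Both are
  charged to \<open>T(\<gamma> r, f) / r\<close>: for non-constant \<open>f\<close> the
  characteristic exceeds \<open>max 1 K\<close> on all large regular radii, and the smaller radii
  join the exceptional set. For constant \<open>f\<close> the left side is 0.

  The value \<open>sqrt \<gamma>\<close> comes from the annuli. For \<open>r\<close> in the m-th
  annulus the points with \<open>|a| <= \<beta> r\<close> lie within radius
  \<open>\<beta>^(m+2) = \<gamma> \<beta>^m <= \<gamma> r\<close>, so \<open>n(\<gamma> r)\<close>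
  counts them; all other points are at distance of order \<open>r\<close> from \<open>z\<close> and
  \<open>z + \<eta>\<close>. That \<open>\<gamma>\<close> is also the exponent of the logarithm does
  no harm: the logarithmic measures \<open>(m+1)^(-\<kappa>)\<close> are summable as soon as
  \<open>\<kappa> > 1\<close>, and any gap between \<open>\<kappa>\<close> and the exponent absorbs
  the remaining factors for large \<open>r\<close>.

  For (b), \<open>n(\<gamma> r)\<close> is controlled by \<open>T(\<gamma>^2 r, f)\<close>, whence
  the second regular circle.\<close>

lemma cauchy_circle_mean:
  fixes F :: "complex \<Rightarrow> complex"
  assumes "continuous_on (cball 0 R) F" "F holomorphic_on ball 0 R" "cmod z < R"
  shows "((\<lambda>t. F (of_real R * cis t) * (of_real R * cis t / (of_real R * cis t - z)))
           has_integral (of_real (2 * pi) * F z)) {0..2 * pi}"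
proof -
  have "((\<lambda>u. F u / (u - z)) has_contour_integral (2 * of_real pi * \<i> * F z)) (circlepath 0 R)"
    using assms by (intro Cauchy_integral_circlepath) auto
  then have "((\<lambda>u. F u / (u - z)) has_contour_integral (2 * of_real pi * \<i> * F z))
               (part_circlepath 0 R 0 (2 * pi))"
    by (simp add: circlepath_def)
  then have "((\<lambda>t. F (of_real R * cis t) / (of_real R * cis t - z) * of_real R * \<i> * cis t)
               has_integral (2 * of_real pi * \<i> * F z)) {0..2 * pi}"
    by (subst (asm) has_contour_integral_part_circlepath_iff) auto
  from has_integral_mult_right[OF this, of "-\<i>"] show ?thesis
    by (elim has_integral_eq_rhs[OF has_integral_eq[rotated]]) (auto simp: algebra_simps)
qed

text \<open>The kernel \<open>2 u / (u - z)\<close> is the Schwarz kernel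
  \<open>(u + z) / (u - z)\<close> plus 1, so only boundary values of \<open>Re h\<close> enter. The
  term \<open>cnj (h 0)\<close> does not depend on \<open>z\<close> and cancels in
  differences.\<close>

lemma schwarz_integral:
  fixes h :: "complex \<Rightarrow> complex"
  assumes h: "continuous_on (cball 0 R) h" "h holomorphic_on ball 0 R" and z: "cmod z < R"
  shows "((\<lambda>t. of_real (2 * Re (h (of_real R * cis t))) * (of_real R * cis t / (of_real R * cis t - z)))
           has_integral (of_real (2 * pi) * (h z + cnj (h 0)))) {0..2 * pi}"
proof -
  have R: "R > 0" using z norm_ge_zero[of z] by linarith
  \<comment> \<open>On \<open>|u| = R\<close> the conjugate of \<open>k u\<close> is \<open>cnj (h u) * (u / (u - z))\<close>, as \<open>cnj u = R^2 / u\<close> there.\<close>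
  define k where "k = (\<lambda>u. h u * (of_real (R\<^sup>2) / (of_real (R\<^sup>2) - cnj z * u)))"
  have nz: "of_real (R\<^sup>2) - cnj z * u \<noteq> 0" if "cmod u \<le> R" for u
  proof
    assume "of_real (R\<^sup>2) - cnj z * u = 0"
    then have "cmod (cnj z * u) = cmod (of_real (R\<^sup>2))" by simp
    then have "cmod z * cmod u = R * R"
      by (simp only: norm_mult norm_of_real complex_mod_cnj) (simp add: power2_eq_square)
    moreover have "cmod z * cmod u < R * R"
      using mult_left_mono[OF that norm_ge_zero[of z]] mult_strict_right_mono[OF z R] by linarith
    ultimately show False by simp
  qed
  have "((\<lambda>t. k (of_real R * cis t) * (of_real R * cis t / (of_real R * cis t - 0)))
           has_integral (of_real (2 * pi) * k 0)) {0..2 * pi}"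
  proof (rule cauchy_circle_mean)
    show "continuous_on (cball 0 R) k"
      unfolding k_def by (intro continuous_intros h ballI nz) auto
    show "k holomorphic_on ball 0 R"
      unfolding k_def by (intro holomorphic_intros h nz) auto
  qed (use R in auto)
  then have "((\<lambda>t. k (of_real R * cis t)) has_integral (of_real (2 * pi) * h 0)) {0..2 * pi}"
    using R by (simp add: k_def)
  then have 1: "((\<lambda>t. cnj (k (of_real R * cis t))) has_integral (of_real (2 * pi) * cnj (h 0))) {0..2 * pi}"
    by (subst (asm) has_integral_cnj[symmetric]) (simp add: o_def)
  have eq: "cnj (k (of_real R * cis t)) =
     cnj (h (of_real R * cis t)) * (of_real R * cis t / (of_real R * cis t - z))" for t
  proof -
    have "cis t * cnj (cis t) = 1" by (simp add: cis_cnj cis_mult)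
    then have c: "of_real (R\<^sup>2) - z * (of_real R * cnj (cis t)) 
        = of_real R * cnj (cis t) * (of_real R * cis t - z)"
      by (simp add: power2_eq_square algebra_simps)
    have c2: "of_real (R\<^sup>2) = of_real R * cnj (cis t) * (of_real R * cis t)"
      using \<open>cis t * cnj (cis t) = 1\<close> by (simp add: power2_eq_square algebra_simps)
    have "of_real R * cnj (cis t) \<noteq> 0" using R by (simp add: cis_cnj)
    then have "of_real (R\<^sup>2) / (of_real (R\<^sup>2) - z * (of_real R * cnj (cis t)))
          = of_real R * cis t / (of_real R * cis t - z)"
      unfolding c unfolding c2 by (rule mult_divide_mult_cancel_left)
    then show ?thesis by (simp add: k_def del: times_divide_eq_right)
  qed
  have "((\<lambda>t. h (of_real R * cis t) * (of_real R * cis t / (of_real R * cis t - z)) +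
           cnj (k (of_real R * cis t)))
           has_integral (of_real (2 * pi) * h z + of_real (2 * pi) * cnj (h 0))) {0..2 * pi}"
    by (intro has_integral_add 1 cauchy_circle_mean h z)
  moreover have "h (of_real R * cis t) * (of_real R * cis t / (of_real R * cis t - z)) +
           cnj (k (of_real R * cis t)) =
        of_real (2 * Re (h (of_real R * cis t))) * (of_real R * cis t / (of_real R * cis t - z))" for t
    unfolding eq distrib_right[symmetric] complex_add_cnj ..
  ultimately show ?thesis by (simp add: algebra_simps)
qed

lemma harmonic_mean_value:
  fixes h :: "complex \<Rightarrow> complex"
  assumes h: "continuous_on (cball 0 R) h" "h holomorphic_on ball 0 R" and "R > 0"
  shows "((\<lambda>t. Re (h (of_real R * cis t))) has_integral (2 * pi * Re (h 0))) {0..2 * pi}"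
proof -
  have "((\<lambda>t. h (of_real R * cis t) * (of_real R * cis t / (of_real R * cis t - 0)))
           has_integral (of_real (2 * pi) * h 0)) {0..2 * pi}"
    using assms by (intro cauchy_circle_mean) auto
  from has_integral_Re[OF this] show ?thesis using assms by simp
qed

text \<open>Subtracting the Schwarz integrals at \<open>w\<close> and \<open>z\<close> leaves the
  kernel \<open>u (w - z) / ((u - w) (u - z))\<close>, which is small because both points stay away
  from the circle. No bound on \<open>Im h\<close> is required.\<close>

lemma harmonic_difference_bound:
  fixes h :: "complex \<Rightarrow> complex"
  assumes h: "continuous_on (cball 0 R) h" "h holomorphic_on ball 0 R"
    and z: "cmod z < R" and w: "cmod w < R"
  shows "cmod (h w - h z) \<le> 2 * R * cmod (w - z) / ((R - cmod w) * (R - cmod z)) *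
           (1 / (2 * pi) * integral {0..2 * pi} (\<lambda>t. \<bar>Re (h (of_real R * cis t))\<bar>))"
proof -
  have R: "R > 0" using z norm_ge_zero[of z] by linarith
  define C where "C = 2 * R * cmod (w - z) / ((R - cmod w) * (R - cmod z))"
  define \<zeta> where "\<zeta> = (\<lambda>t. of_real R * cis t)"
  have n\<zeta>: "cmod (\<zeta> t) = R" for t using R by (simp add: \<zeta>_def norm_mult)
  have "((\<lambda>t. of_real (2 * Re (h (\<zeta> t))) * (\<zeta> t / (\<zeta> t - w)) -
             of_real (2 * Re (h (\<zeta> t))) * (\<zeta> t / (\<zeta> t - z)))
           has_integral (of_real (2 * pi) * (h w + cnj (h 0)) - of_real (2 * pi) * (h z + cnj (h 0)))) {0..2 * pi}"
    unfolding \<zeta>_def by (intro has_integral_diff schwarz_integral assms)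
  then have I: "((\<lambda>t. of_real (2 * Re (h (\<zeta> t))) * (\<zeta> t / (\<zeta> t - w)) -
             of_real (2 * Re (h (\<zeta> t))) * (\<zeta> t / (\<zeta> t - z)))
           has_integral (of_real (2 * pi) * (h w - h z))) {0..2 * pi}"
    by (simp add: algebra_simps)
  have cont: "continuous_on {0..2 * pi} (\<lambda>t. \<bar>Re (h (\<zeta> t))\<bar>)"
  proof -
    have "continuous_on {0..2*pi} (\<lambda>t. h (\<zeta> t))"
      by (rule continuous_on_compose2[OF h(1)]) (use R in \<open>auto simp: \<zeta>_def norm_mult intro!: continuous_intros\<close>)
    then show ?thesis by (intro continuous_intros)
  qed
  have bnd: "norm (of_real (2 * Re (h (\<zeta> t))) * (\<zeta> t / (\<zeta> t - w)) -
             of_real (2 * Re (h (\<zeta> t))) * (\<zeta> t / (\<zeta> t - z))) \<le> C * \<bar>Re (h (\<zeta> t))\<bar>" for t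
  proof -
    have dw: "R - cmod w \<le> cmod (\<zeta> t - w)" and dz: "R - cmod z \<le> cmod (\<zeta> t - z)"
      using norm_triangle_ineq2[of "\<zeta> t" w] norm_triangle_ineq2[of "\<zeta> t" z] by (simp_all add: n\<zeta>)
    have nz: "\<zeta> t - w \<noteq> 0" "\<zeta> t - z \<noteq> 0" using dw dz z w by auto
    have "of_real (2 * Re (h (\<zeta> t))) * (\<zeta> t / (\<zeta> t - w)) -
             of_real (2 * Re (h (\<zeta> t))) * (\<zeta> t / (\<zeta> t - z))
          = of_real (2 * Re (h (\<zeta> t))) * (\<zeta> t * (w - z) / ((\<zeta> t - w) * (\<zeta> t - z)))"
      using nz by (simp add: divide_simps) (simp add: algebra_simps)
    also have "norm \<dots> = 2 * \<bar>Re (h (\<zeta> t))\<bar> * (R * cmod (w - z) / (cmod (\<zeta> t - w) * cmod (\<zeta> t - z)))"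
      by (simp add: norm_mult norm_divide n\<zeta>)
    also have "\<dots> \<le> 2 * \<bar>Re (h (\<zeta> t))\<bar> * (R * cmod (w - z) / ((R - cmod w) * (R - cmod z)))"
      using z w dw dz R by (intro mult_left_mono divide_left_mono mult_mono mult_pos_pos) auto
    finally show ?thesis by (simp add: C_def mult_ac)
  qed
  have "norm (integral {0..2*pi} (\<lambda>t. of_real (2 * Re (h (\<zeta> t))) * (\<zeta> t / (\<zeta> t - w)) -
             of_real (2 * Re (h (\<zeta> t))) * (\<zeta> t / (\<zeta> t - z)))) \<le> integral {0..2*pi} (\<lambda>t. C * \<bar>Re (h (\<zeta> t))\<bar>)"
  proof (rule integral_norm_bound_integral)
    show "(\<lambda>t. C * \<bar>Re (h (\<zeta> t))\<bar>) integrable_on {0..2*pi}"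
      by (intro integrable_continuous_interval continuous_intros cont)
  qed (use has_integral_integrable[OF I] bnd in auto)
  then have "2 * pi * cmod (h w - h z) \<le> C * integral {0..2*pi} (\<lambda>t. \<bar>Re (h (\<zeta> t))\<bar>)"
    using integral_unique[OF I] by (simp add: norm_mult)
  then have "cmod (h w - h z) \<le> C * (1 / (2 * pi) * integral {0..2*pi} (\<lambda>t. \<bar>Re (h (\<zeta> t))\<bar>))"
    by (simp add: field_simps)
  then show ?thesis by (simp add: C_def \<zeta>_def)
qed

section \<open>Zeros, poles and Blaschke factors\<close>

lemma log_plus_nonneg: "log_plus x \<ge> 0"
  by (simp add: log_plus_def)

definition blaschke :: "real \<Rightarrow> complex \<Rightarrow> complex \<Rightarrow> complex" where
  "blaschke R a z = of_real R * (z - a) / (of_real (R\<^sup>2) - cnj a * z)"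

text \<open>The condition is on the denominator instead of \<open>cmod z <= R\<close> because the
  factorization below works on an open set reaching slightly beyond the closed disc.\<close>

lemma zorder_blaschke:
  assumes "R > 0" "cmod a < R" "of_real (R\<^sup>2) - cnj a * z \<noteq> 0"
  shows "zorder (blaschke R a) z = (if z = a then 1 else 0)"
proof -
  define S where "S = {w. of_real (R\<^sup>2) - cnj a * w \<noteq> 0}"
  have S: "open S" "z \<in> S"
    unfolding S_def using assms by (auto intro!: open_Collect_neq continuous_intros)
  show ?thesis
  proof (cases "z = a")
    case True
    have "zorder (blaschke R a) a = 1"
      by (rule zorder_eqI[of S _ "\<lambda>w. of_real R / (of_real (R\<^sup>2) - cnj a * w)"])
        (use S True assms in \<open>auto simp: blaschke_def S_def intro!: holomorphic_intros\<close>)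
    with True show ?thesis by simp
  next
    case False
    have "blaschke R a holomorphic_on S"
      unfolding blaschke_def by (intro holomorphic_intros) (auto simp: S_def)
    then have "blaschke R a analytic_on {z}" using S analytic_at by blast
    then show ?thesis
      using False assms by (subst zorder_eq_0I) (auto simp: blaschke_def)
  qed
qed

text \<open>Order 0 excludes a pole and an isolated zero, and these are the only ways in which a
  nicely meromorphic function that is not locally zero can take the value 0.\<close>

lemma zero_free_analytic:
  assumes "F meromorphic_on {z}" "eventually (\<lambda>w. F w \<noteq> 0) (at z)" "zorder F z = 0"
  shows "remove_sings F analytic_on {z} \<and> remove_sings F z \<noteq> 0"
proof -
  have np: "\<not> is_pole F z" "\<not> isolated_zero F z"
    using assms isolated_pole_imp_neg_zorder[of F z] zorder_isolated_zero_pos'[of F z]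
    by (auto simp: meromorphic_at_iff)
  have nice: "remove_sings F nicely_meromorphic_on {z}"
    using assms remove_sings_nicely_meromorphic by blast
  have iso: "isolated_singularity_at F z" using assms by (simp add: meromorphic_at_iff)
  have "eventually (\<lambda>w. remove_sings F w = F w) (at z)"
    using eventually_remove_sings_eq_at[OF iso] .
  then have "eventually (\<lambda>w. remove_sings F w \<noteq> 0) (at z)"
    using assms(2) by eventually_elim auto
  moreover have "\<not> is_pole (remove_sings F) z" "\<not> isolated_zero (remove_sings F) z"
    using np iso assms(1) by (auto simp: meromorphic_at_iff)
  ultimately have "remove_sings F z \<noteq> 0"
    using zero_or_pole[OF nice] by blast
  moreover have "remove_sings F analytic_on {z}"
    using nicely_meromorphic_on_imp_analytic_at[OF nice] \<open>\<not> is_pole (remove_sings F) z\<close> by blast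
  ultimately show ?thesis by blast
qed
lemma blaschke_denominator_nonzero:
  assumes "cmod a < R" "cmod z \<le> R"
  shows "of_real (R\<^sup>2) - cnj a * z \<noteq> 0"
proof
  assume "of_real (R\<^sup>2) - cnj a * z = 0"
  then have "cmod (cnj a * z) = cmod (of_real (R\<^sup>2))" by simp
  then have "cmod a * cmod z = R * R"
    by (simp only: norm_mult norm_of_real complex_mod_cnj) (simp add: power2_eq_square)
  moreover have "cmod a * cmod z < R * R"
    using mult_left_mono[OF assms(2) norm_ge_zero[of a]]
      mult_strict_right_mono[OF assms(1), of R] assms norm_ge_zero[of a] by linarith
  ultimately show False by simp
qed

lemma norm_blaschke_circle:
  assumes "cmod a < R" "cmod z = R"
  shows "cmod (blaschke R a z) = 1"
proof -
  have "of_real (R\<^sup>2) - cnj a * z = z * cnj (z - a)"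
    using complex_norm_square[of z] assms(2) by (simp add: algebra_simps)
  then have "cmod (of_real (R\<^sup>2) - cnj a * z) = R * cmod (z - a)"
    using assms(2) by (metis complex_mod_cnj norm_mult)
  moreover have "z \<noteq> a" using assms by auto
  moreover have "R > 0" using assms norm_ge_zero[of a] by linarith
  ultimately show ?thesis by (simp add: blaschke_def norm_divide norm_mult)
qed

lemma blaschke_nonzero:
  assumes "cmod a < R" "cmod z \<le> R" "z \<noteq> a"
  shows "blaschke R a z \<noteq> 0"
  using blaschke_denominator_nonzero[OF assms(1,2)] assms norm_ge_zero[of a] by (auto simp: blaschke_def)

locale plane_meromorphic =
  fixes f :: "complex \<Rightarrow> complex"
  assumes nice: "f nicely_meromorphic_on UNIV" and nontrivial: "f \<noteq> (\<lambda>_. 0)"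
begin

text \<open>A nicely meromorphic function vanishes at its poles, so \<open>f a = 0\<close> says zero or pole.\<close>
definition divisor_upto :: "real \<Rightarrow> complex set" where
  "divisor_upto t = {a. f a = 0 \<and> cmod a \<le> t}"

definition ord_at :: "complex \<Rightarrow> nat" where
  "ord_at a = nat \<bar>zorder f a\<bar>"

lemma mero: "f meromorphic_on A"
  using nice meromorphic_on_subset[of f UNIV A] by (auto simp: nicely_meromorphic_on_def)

lemma nonzero_cosparse: "\<forall>\<^sub>\<approx>z\<in>UNIV. f z \<noteq> 0"
  using nicely_meromorphic_imp_constant_or_avoid[OF nice, of 0] nontrivial by auto

lemma eventually_nonzero: "eventually (\<lambda>w. f w \<noteq> 0) (at z)"
  using nonzero_cosparse by (auto simp: eventually_cosparse_open_eq)

lemma finite_divisor_upto: "finite (divisor_upto t)"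
proof -
  have "{a. f a = 0} sparse_in UNIV"
    using nonzero_cosparse by (simp add: eventually_cosparse)
  then have "finite (cball 0 t \<inter> {a. f a = 0})"
    using sparse_in_compact_finite[of "{a. f a = 0}" "cball 0 t"] sparse_in_subset[of _ UNIV "cball 0 t"] by auto
  then show ?thesis
    by (rule finite_subset[rotated]) (auto simp: divisor_upto_def)
qed

lemma zero_iff_zorder: "f a = 0 \<longleftrightarrow> zorder f a \<noteq> 0"
proof (cases "f a = 0")
  case True
  then have "isolated_zero f a \<or> is_pole f a"
    using zero_or_pole[OF nice _ True eventually_nonzero] by auto
  moreover have iso: "isolated_singularity_at f a"
    using mero[of "{a}"] by (simp add: meromorphic_at_iff)
  ultimately show ?thesis
    using True zorder_isolated_zero_pos'[OF _ iso] isolated_pole_imp_neg_zorder[OF iso] by fastforce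
next
  case False
  then have "f analytic_on {a}"
    using nicely_meromorphic_on_imp_analytic_at[OF nice] is_pole_zero_at_nicely_mero[OF nice] by blast
  with False show ?thesis by (simp add: zorder_eq_0I)
qed

lemma is_pole_iff: "is_pole f a \<longleftrightarrow> zorder f a < 0"
  using zorder_neg_imp_is_pole[OF mero eventually_nonzero] isolated_pole_imp_neg_zorder[of f a]
    mero[of "{a}"] by (auto simp: meromorphic_at_iff)

lemma is_pole_recip_iff: "is_pole (\<lambda>z. 1 / f z) a \<longleftrightarrow> zorder f a > 0"
proof -
  have "is_pole (\<lambda>z. 1 / f z) a \<longleftrightarrow> isolated_zero f a"
    using is_pole_inverse_iff[of f a] by (simp add: divide_inverse)
  also have "\<dots> \<longleftrightarrow> zorder f a > 0"
    using zorder_pos_imp_isolated_zero[OF mero eventually_nonzero] zorder_isolated_zero_pos'[of f a]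
      mero[of "{a}"] by (auto simp: meromorphic_at_iff)
  finally show ?thesis .
qed

lemma zorder_recip: "zorder (\<lambda>z. 1 / f z) a = - zorder f a"
  using zorder_divide[of "\<lambda>_. 1" a f] mero[of "{a}"]
    eventually_frequently[OF _ eventually_nonzero[of a]] by auto

lemma pole_count_eq: "pole_count t f = (\<Sum>a\<in>divisor_upto t. nat (- zorder f a))"
  unfolding pole_count_def
  by (rule sum.mono_neutral_left)
    (use finite_divisor_upto is_pole_iff zero_iff_zorder in \<open>auto simp: divisor_upto_def\<close>)

lemma recip_count_eq: "pole_count t (\<lambda>z. 1 / f z) = (\<Sum>a\<in>divisor_upto t. nat (zorder f a))"
  unfolding pole_count_def
  by (subst zorder_recip, rule sum.mono_neutral_cong_left)
    (use finite_divisor_upto is_pole_recip_iff zero_iff_zorder in \<open>auto simp: divisor_upto_def\<close>)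

lemma zero_pole_count_eq: "zero_pole_count t f = (\<Sum>a\<in>divisor_upto t. ord_at a)"
  unfolding zero_pole_count_def pole_count_eq recip_count_eq sum.distrib[symmetric] ord_at_def
  by (intro sum.cong) auto

text \<open>Dividing by the Blaschke product \<open>B\<close> leaves order 0 everywhere near the
  closed disc, so \<open>f / B\<close> extends to a zero-free holomorphic function and has a
  logarithm on a disc. The Schwarz integral needs \<open>h\<close> continuous up to the circle; the
  logarithm is therefore taken on a disc of radius \<open>R + e\<close>, with \<open>e\<close> from
  compactness.\<close>

lemma blaschke_factorization:
  assumes R: "R > 0" and avoid: "\<And>a. f a = 0 \<Longrightarrow> cmod a \<noteq> R"
  obtains h where "continuous_on (cball 0 R) h" "h holomorphic_on ball 0 R"
    "\<And>z. cmod z \<le> R \<Longrightarrow> f z \<noteq> 0 \<Longrightarrow>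
       f z = (\<Prod>a\<in>divisor_upto R. blaschke R a z powi zorder f a) * exp (h z)"
proof -
  define D where "D = divisor_upto R"
  have finD: "finite D" by (simp add: D_def finite_divisor_upto)
  have D: "cmod a < R" if "a \<in> D" for a
    using that avoid[of a] by (auto simp: D_def divisor_upto_def)
  define B where "B = (\<lambda>z. \<Prod>a\<in>D. blaschke R a z powi zorder f a)"
  \<comment> \<open>On \<open>U\<close> the only zeros and poles of \<open>f\<close> are those in
    \<open>D\<close>, and no Blaschke factor has a pole; hence \<open>f\<close> and \<open>B\<close>
    have equal orders there.\<close>
  define U where "U = - {a \<in> {a. f a = 0} . a \<notin> D} \<inter> (\<Inter>a\<in>D. {z. of_real (R\<^sup>2) - cnj a * z \<noteq> 0})"
  have "{a. f a = 0} sparse_in UNIV"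
    using nonzero_cosparse by (simp add: eventually_cosparse)
  then have "closed {a \<in> {a. f a = 0} . a \<notin> D}"
    by (intro sparse_in_UNIV_imp_closed) (rule sparse_in_subset2[of "{a. f a = 0}"], auto)
  then have "open U"
    unfolding U_def using finD
    by (intro open_Int open_INT ballI open_Collect_neq continuous_intros) auto
  moreover have "cball 0 R \<subseteq> U"
  proof
    fix z :: complex assume "z \<in> cball 0 R"
    then have "cmod z \<le> R" by simp
    then show "z \<in> U"
      using blaschke_denominator_nonzero[OF D, of _ z]
      unfolding U_def by (auto simp only: D_def divisor_upto_def mem_Collect_eq)
  qed
  ultimately obtain e where e: "e > 0" "(\<Union>x\<in>cball 0 R. ball x e) \<subseteq> U"
    using compact_subset_open_imp_ball_epsilon_subset[of "cball 0 R" U] by auto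
  have sub: "ball 0 (R + e) \<subseteq> U"
  proof
    fix z :: complex assume "z \<in> ball 0 (R + e)"
    then have z: "cmod z < R + e" by simp
    show "z \<in> U"
    proof (cases "cmod z \<le> R")
      case True
      then have "z \<in> ball z e" "z \<in> cball 0 R" using e by auto
      then show ?thesis using e by blast
    next
      case False
      \<comment> \<open>The radial projection of \<open>z\<close> to the circle, at distance
        \<open>cmod z - R < e\<close> from \<open>z\<close>.\<close>
      define x where "x = of_real (R / cmod z) * z"
      have "z - x = of_real (1 - R / cmod z) * z" by (simp add: x_def algebra_simps)
      then have "cmod (z - x) = \<bar>1 - R / cmod z\<bar> * cmod z" by (simp only: norm_mult norm_of_real)
      also have "\<bar>1 - R / cmod z\<bar> = 1 - R / cmod z" using False R by (intro abs_of_nonneg) (simp add: divide_le_eq_1)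
      also have "(1 - R / cmod z) * cmod z = cmod z - R" using False R by (auto simp: field_simps)
      finally have "cmod (z - x) < e" using z by simp
      moreover have "cmod x = R"
      proof -
        have "cmod x = \<bar>R / cmod z\<bar> * cmod z" unfolding x_def by (simp only: norm_mult norm_of_real)
        moreover have "z \<noteq> 0" using False R by auto
        ultimately show ?thesis using R by simp
      qed
      ultimately have "z \<in> ball x e" "x \<in> cball 0 R" by (auto simp: dist_norm norm_minus_commute)
      then show ?thesis using e by blast
    qed
  qed
  have Bmero: "B meromorphic_on U"
    unfolding B_def blaschke_def
    by (intro meromorphic_intros)
  have Bmero1: "(\<lambda>w. blaschke R a w) meromorphic_on A" for A a
    unfolding blaschke_def by (intro meromorphic_intros)
  have ev1: "eventually (\<lambda>w. blaschke R a w \<noteq> 0) (at z)" if "a \<in> D" "z \<in> U" for a z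
  proof -
    have "open {z. of_real (R\<^sup>2) - cnj a * z \<noteq> 0}"
      by (intro open_Collect_neq continuous_intros)
    moreover have "z \<in> {z. of_real (R\<^sup>2) - cnj a * z \<noteq> 0}" using that by (auto simp: U_def)
    ultimately have "eventually (\<lambda>w. w \<in> {z. of_real (R\<^sup>2) - cnj a * z \<noteq> 0}) (at z)"
      by (rule eventually_at_in_open')
    moreover have "eventually (\<lambda>w. w \<noteq> a) (at z)"
      using eventually_neq_at_within[of a z UNIV] by simp
    ultimately show ?thesis
      by eventually_elim (use R in \<open>auto simp: blaschke_def\<close>)
  qed
  have evB: "eventually (\<lambda>w. B w \<noteq> 0) (at z)" if "z \<in> U" for z
  proof -
    have "eventually (\<lambda>w. \<forall>a\<in>D. blaschke R a w \<noteq> 0) (at z)"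
      using finD ev1 that by (simp add: eventually_ball_finite_distrib)
    then show ?thesis
      by eventually_elim (use finD in \<open>auto simp: B_def power_int_eq_0_iff\<close>)
  qed
  have zB: "zorder B z = zorder f z" if "z \<in> U" for z
  proof -
    have "zorder B z = (\<Sum>a\<in>D. zorder (\<lambda>w. blaschke R a w powi zorder f a) z)"
      unfolding B_def
      by (rule zorder_prod) (use evB[OF that] in \<open>auto simp: B_def intro!: meromorphic_intros Bmero1\<close>)
    also have "\<dots> = (\<Sum>a\<in>D. zorder f a * (if z = a then 1 else 0))"
    proof (intro sum.cong refl)
      fix a assume a: "a \<in> D"
      have "zorder (\<lambda>w. blaschke R a w powi zorder f a) z = zorder f a * zorder (blaschke R a) z"
        by (rule zorder_power_int[OF Bmero1])
          (rule eventually_frequently[OF _ ev1[OF a that]], simp)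
      also have "zorder (blaschke R a) z = (if z = a then 1 else 0)"
        using that a D R by (intro zorder_blaschke) (auto simp: U_def)
      finally show "zorder (\<lambda>w. blaschke R a w powi zorder f a) z = zorder f a * (if z = a then 1 else 0)" .
    qed
    also have "\<dots> = (\<Sum>a\<in>D. if z = a then zorder f a else 0)" by (intro sum.cong) auto
    also have "\<dots> = (if z \<in> D then zorder f z else 0)" using finD by simp
    also have "\<dots> = zorder f z" using that zero_iff_zorder[of z] by (auto simp: U_def)
    finally show ?thesis .
  qed
  define F where "F = (\<lambda>w. f w / B w)"
  have F: "F meromorphic_on {z}" "eventually (\<lambda>w. F w \<noteq> 0) (at z)" "zorder F z = 0" if z: "z \<in> U" for z
  proof -
    have B': "B meromorphic_on {z}" using Bmero z meromorphic_on_subset by blast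
    show "F meromorphic_on {z}" unfolding F_def by (intro meromorphic_intros mero B')
    show "eventually (\<lambda>w. F w \<noteq> 0) (at z)"
      using evB[OF z] eventually_nonzero[of z] by eventually_elim (auto simp: F_def)
    have "zorder F z = zorder f z - zorder B z"
      unfolding F_def
      by (rule zorder_divide[OF mero _ B'])
        (use evB[OF z] eventually_nonzero[of z] in \<open>auto intro: eventually_frequently\<close>)
    then show "zorder F z = 0" using zB[OF z] by simp
  qed
  define G where "G = remove_sings F"
  have G: "G analytic_on {z}" "G z \<noteq> 0" if "z \<in> U" for z
    using zero_free_analytic[OF F[OF that]] by (auto simp: G_def)
  have "G analytic_on ball 0 (R + e)"
    using G(1) sub analytic_on_analytic_at by blast
  then have Ghol: "G holomorphic_on ball 0 (R + e)"
    by (simp add: analytic_imp_holomorphic)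
  obtain h where h: "h holomorphic_on ball 0 (R + e)" "\<And>z. z \<in> ball 0 (R + e) \<Longrightarrow> G z = exp (h z)"
    using contractible_imp_holomorphic_log[OF Ghol convex_imp_contractible[OF convex_ball]] G(2) sub by blast
  show thesis
  proof
    show "continuous_on (cball 0 R) h"
      using h(1) e(1) by (intro holomorphic_on_imp_continuous_on) (elim holomorphic_on_subset, auto)
    show "h holomorphic_on ball 0 R"
      using h(1) e(1) by (elim holomorphic_on_subset) auto
    fix z assume z: "cmod z \<le> R" "f z \<noteq> 0"
    then have zU: "z \<in> ball 0 (R + e)" using e by simp
    have za: "z \<noteq> a" if "a \<in> D" for a using that z by (auto simp: D_def divisor_upto_def)
    \<comment> \<open>\<open>remove_sings\<close> keeps the value at a point of analyticity. This
      gives the factorization at the point \<open>z\<close> itself and not merely near it.\<close>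
    have "F analytic_on {z}"
    proof -
      have "\<not> is_pole f z" using z is_pole_iff zero_iff_zorder by auto
      then have "f analytic_on {z}"
        using nicely_meromorphic_on_imp_analytic_at[OF nice] by blast
      moreover have "blaschke R a analytic_on {z}" if "a \<in> D" for a
        unfolding blaschke_def using blaschke_denominator_nonzero[OF D[OF that] z(1)]
        by (intro analytic_intros) auto
      then have "B analytic_on {z}"
        unfolding B_def using blaschke_nonzero[OF D z(1)] za 
        by (intro analytic_intros) auto
      moreover have "B z \<noteq> 0"
        unfolding B_def using finD blaschke_nonzero[OF D z(1)] za by (auto simp: power_int_eq_0_iff)
      ultimately show ?thesis unfolding F_def by (intro analytic_intros) auto
    qed
    then have "G z = F z" by (simp add: G_def)
    moreover have "B z \<noteq> 0"
      unfolding B_def using finD blaschke_nonzero[OF D z(1)] za by (auto simp: power_int_eq_0_iff)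
    ultimately have "f z = B z * exp (h z)"
      using h(2)[OF zU] by (simp add: F_def)
    then show "f z = (\<Prod>a\<in>divisor_upto R. blaschke R a z powi zorder f a) * exp (h z)"
      by (simp add: B_def D_def)
  qed
qed

end

section \<open>Logarithms on circles and Jensen's formula\<close>

lemma ln_power_int: "x > 0 \<Longrightarrow> ln (x powi n) = of_int n * ln (x::real)"
  by (simp flip: powr_real_of_int')

context plane_meromorphic
begin

text \<open>On regular radii this is \<open>m(R, f) + m(R, 1/f)\<close>.\<close>

definition mean_abs_log :: "real \<Rightarrow> real" where
  "mean_abs_log R = 1 / (2 * pi) * integral {0..2 * pi} (\<lambda>t. \<bar>ln (cmod (f (of_real R * cis t)))\<bar>)"

text \<open>Such circles carry a continuous \<open>log |f|\<close> and admit the Blaschke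
  factorization. The zeros and poles are countable, so only countably many positive radii
  fail.\<close>

definition regular_radius :: "real \<Rightarrow> bool" where
  "regular_radius R \<longleftrightarrow> R > 0 \<and> (\<forall>a. f a = 0 \<longrightarrow> cmod a \<noteq> R)"

lemma divisor_upto_less: "regular_radius R \<Longrightarrow> a \<in> divisor_upto R \<Longrightarrow> cmod a < R"
  by (auto simp: regular_radius_def divisor_upto_def less_le)

text \<open>Blaschke factors have modulus 1 on the circle, which is why \<open>Re h\<close> agrees
  with \<open>log |f|\<close> there.\<close>

lemma ln_factorization:
  assumes "regular_radius R"
  obtains h where "continuous_on (cball 0 R) h" "h holomorphic_on ball 0 R"
    "\<And>z. cmod z \<le> R \<Longrightarrow> f z \<noteq> 0 \<Longrightarrow>
       f z = (\<Prod>a\<in>divisor_upto R. blaschke R a z powi zorder f a) * exp (h z)"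
    "\<And>z. cmod z \<le> R \<Longrightarrow> f z \<noteq> 0 \<Longrightarrow>
       ln (cmod (f z)) = (\<Sum>a\<in>divisor_upto R. of_int (zorder f a) * ln (cmod (blaschke R a z))) + Re (h z)"
    "\<And>t. ln (cmod (f (of_real R * cis t))) = Re (h (of_real R * cis t))"
proof -
  have R: "R > 0" using assms by (simp add: regular_radius_def)
  have avoid: "cmod a \<noteq> R" if "f a = 0" for a using that assms by (simp add: regular_radius_def)
  obtain h where h: "continuous_on (cball 0 R) h" "h holomorphic_on ball 0 R"
    "\<And>z. cmod z \<le> R \<Longrightarrow> f z \<noteq> 0 \<Longrightarrow>
       f z = (\<Prod>a\<in>divisor_upto R. blaschke R a z powi zorder f a) * exp (h z)"
    by (rule blaschke_factorization[OF R avoid]) (assumption, (rule that; assumption))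
  have ln: "ln (cmod (f z)) = (\<Sum>a\<in>divisor_upto R. of_int (zorder f a) * ln (cmod (blaschke R a z))) + Re (h z)"
    if z: "cmod z \<le> R" "f z \<noteq> 0" for z
  proof -
    have nz: "cmod (blaschke R a z) > 0" if "a \<in> divisor_upto R" for a
    proof -
      have "z \<noteq> a" using that z by (auto simp: divisor_upto_def)
      then show ?thesis using blaschke_nonzero[OF divisor_upto_less[OF assms that] z(1)] by simp
    qed
    have "cmod (f z) = (\<Prod>a\<in>divisor_upto R. cmod (blaschke R a z) powi zorder f a) * exp (Re (h z))"
      by (subst h(3)[OF z]) (simp add: norm_mult prod_norm[symmetric] norm_power_int)
    also have "ln \<dots> = ln (\<Prod>a\<in>divisor_upto R. cmod (blaschke R a z) powi zorder f a) + Re (h z)"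
      using nz by (subst ln_mult_pos) (auto intro!: prod_pos zero_less_power_int)
    also have "ln (\<Prod>a\<in>divisor_upto R. cmod (blaschke R a z) powi zorder f a) =
        (\<Sum>a\<in>divisor_upto R. ln (cmod (blaschke R a z) powi zorder f a))"
    proof (rule ln_prod[OF finite_divisor_upto])
      show "cmod (blaschke R a z) powi zorder f a \<noteq> 0" if "a \<in> divisor_upto R" for a
        using nz[OF that] by (simp add: power_int_eq_0_iff)
    qed
    also have "\<dots> = (\<Sum>a\<in>divisor_upto R. of_int (zorder f a) * ln (cmod (blaschke R a z)))"
      using nz by (intro sum.cong refl) (simp add: ln_power_int)
    finally show ?thesis .
  qed
  have circle: "ln (cmod (f (of_real R * cis t))) = Re (h (of_real R * cis t))" for t
  proof -
    have n: "cmod (of_real R * cis t) = R" using R by (simp add: norm_mult)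
    then have "f (of_real R * cis t) \<noteq> 0" using assms by (auto simp: regular_radius_def)
    moreover have "cmod (blaschke R a (of_real R * cis t)) = 1" if "a \<in> divisor_upto R" for a
      using norm_blaschke_circle[OF divisor_upto_less[OF assms that] n] .
    ultimately show ?thesis using ln[of "of_real R * cis t"] n by simp
  qed
  show thesis by (rule that[OF h ln circle])
qed

lemma continuous_ln_circle:
  assumes "regular_radius R"
  shows "continuous_on A (\<lambda>t. ln (cmod (f (of_real R * cis t))))"
proof -
  have R: "R > 0" using assms by (simp add: regular_radius_def)
  obtain h where h: "continuous_on (cball 0 R) h" "h holomorphic_on ball 0 R"
    "\<And>z. cmod z \<le> R \<Longrightarrow> f z \<noteq> 0 \<Longrightarrow>
       f z = (\<Prod>a\<in>divisor_upto R. blaschke R a z powi zorder f a) * exp (h z)"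
    "\<And>z. cmod z \<le> R \<Longrightarrow> f z \<noteq> 0 \<Longrightarrow>
       ln (cmod (f z)) = (\<Sum>a\<in>divisor_upto R. of_int (zorder f a) * ln (cmod (blaschke R a z))) + Re (h z)"
    "\<And>t. ln (cmod (f (of_real R * cis t))) = Re (h (of_real R * cis t))"
    by (rule ln_factorization[OF assms]) (rule that; assumption)
  show ?thesis unfolding h(5)
    by (intro continuous_intros continuous_on_compose2[OF h(1)]) (use R in \<open>auto simp: norm_mult\<close>)
qed

text \<open>The holomorphic part is governed by \<open>log |f|\<close> on the outer circle alone;
  zeros and poles inside remain in the Blaschke sum, to be estimated one by one.\<close>

lemma log_ratio_bound:
  assumes "regular_radius R" and z: "cmod z < R" "f z \<noteq> 0" and w: "cmod w < R" "f w \<noteq> 0"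
  shows "\<bar>ln (cmod (f w / f z))\<bar> \<le>
           2 * R * cmod (w - z) / ((R - cmod w) * (R - cmod z)) * mean_abs_log R +
           (\<Sum>a\<in>divisor_upto R. real (ord_at a) * \<bar>ln (cmod (blaschke R a w)) - ln (cmod (blaschke R a z))\<bar>)"
proof -
  obtain h where h: "continuous_on (cball 0 R) h" "h holomorphic_on ball 0 R"
    "\<And>z. cmod z \<le> R \<Longrightarrow> f z \<noteq> 0 \<Longrightarrow>
       f z = (\<Prod>a\<in>divisor_upto R. blaschke R a z powi zorder f a) * exp (h z)"
    "\<And>z. cmod z \<le> R \<Longrightarrow> f z \<noteq> 0 \<Longrightarrow>
       ln (cmod (f z)) = (\<Sum>a\<in>divisor_upto R. of_int (zorder f a) * ln (cmod (blaschke R a z))) + Re (h z)"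
    "\<And>t. ln (cmod (f (of_real R * cis t))) = Re (h (of_real R * cis t))"
    by (rule ln_factorization[OF assms(1)]) (rule that; assumption)
  have "ln (cmod (f w / f z)) = ln (cmod (f w)) - ln (cmod (f z))"
    using z w by (simp add: norm_divide ln_div)
  also have "\<dots> = (\<Sum>a\<in>divisor_upto R. of_int (zorder f a) * (ln (cmod (blaschke R a w)) - ln (cmod (blaschke R a z))))
                 + Re (h w - h z)"
    using h(4)[of z] h(4)[of w] z w by (simp add: sum_subtractf right_diff_distrib)
  also have "\<bar>\<dots>\<bar> \<le> (\<Sum>a\<in>divisor_upto R. \<bar>of_int (zorder f a) * (ln (cmod (blaschke R a w)) - ln (cmod (blaschke R a z)))\<bar>)
                 + cmod (h w - h z)"
    by (intro order_trans[OF abs_triangle_ineq] add_mono sum_abs abs_Re_le_cmod)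
  also have "(\<Sum>a\<in>divisor_upto R. \<bar>of_int (zorder f a) * (ln (cmod (blaschke R a w)) - ln (cmod (blaschke R a z)))\<bar>)
     = (\<Sum>a\<in>divisor_upto R. real (ord_at a) * \<bar>ln (cmod (blaschke R a w)) - ln (cmod (blaschke R a z))\<bar>)"
    by (intro sum.cong refl) (simp add: abs_mult ord_at_def)
  also have "cmod (h w - h z) \<le> 2 * R * cmod (w - z) / ((R - cmod w) * (R - cmod z)) * mean_abs_log R"
    unfolding mean_abs_log_def h(5) by (rule harmonic_difference_bound[OF h(1,2) z(1) w(1)])
  finally show ?thesis by simp
qed

text \<open>\<open>K\<close> is the logarithm of the modulus of the leading Laurent coefficient of
  \<open>f\<close> at 0, hence the same for all \<open>R\<close> although \<open>h\<close> changes
  with \<open>R\<close>. The mean of \<open>log |f|\<close> is \<open>Re (h 0)\<close>, and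
  \<open>h 0\<close> is found by computing the limit of \<open>f z / z^n\<close> at 0 in two
  ways.\<close>

lemma jensen:
  obtains K where "\<And>R. regular_radius R \<Longrightarrow>
    ((\<lambda>t. ln (cmod (f (of_real R * cis t)))) has_integral
      (2 * pi * (K + (\<Sum>a\<in>divisor_upto R - {0}. of_int (zorder f a) * ln (R / cmod a))
                   + of_int (zorder f 0) * ln R))) {0..2 * pi}"
proof -
  define n where "n = zorder f 0"
  define u where "u = zor_poly f 0"
  have "u 0 \<noteq> 0 \<and> (\<exists>r>0. u holomorphic_on cball 0 r \<and>
          (\<forall>w\<in>cball 0 r - {0}. f w = u w * (w - 0) powi n \<and> u w \<noteq> 0))"
    unfolding u_def n_def
    by (rule zorder_exist)
      (use mero[of "{0}"] eventually_nonzero[of 0] in \<open>auto simp: meromorphic_at_iff intro: eventually_frequently\<close>)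
  then obtain r where u: "u 0 \<noteq> 0" "r > 0" "u holomorphic_on cball 0 r"
    "\<And>w. w \<in> cball 0 r - {0} \<Longrightarrow> f w = u w * w powi n" by auto
  have u_cont: "u \<midarrow>0\<rightarrow> u 0"
  proof -
    have "continuous_on (ball 0 r) u"
      using u(3) by (intro holomorphic_on_imp_continuous_on) (elim holomorphic_on_subset, auto)
    then show ?thesis
      using u(2) continuous_on_eq_continuous_at[of "ball 0 r" u] by (auto simp: isCont_def)
  qed
  show thesis
  proof (rule that[of "ln (cmod (u 0))"])
    fix R assume reg: "regular_radius R"
    then have R: "R > 0" by (simp add: regular_radius_def)
    define D where "D = divisor_upto R - {0}"
    have finD: "finite D" by (simp add: D_def finite_divisor_upto)
    have D: "cmod a < R" "a \<noteq> 0" if "a \<in> D" for a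
      using that divisor_upto_less[OF reg] by (auto simp: D_def)
    obtain h where h: "continuous_on (cball 0 R) h" "h holomorphic_on ball 0 R"
    "\<And>z. cmod z \<le> R \<Longrightarrow> f z \<noteq> 0 \<Longrightarrow>
       f z = (\<Prod>a\<in>divisor_upto R. blaschke R a z powi zorder f a) * exp (h z)"
    "\<And>z. cmod z \<le> R \<Longrightarrow> f z \<noteq> 0 \<Longrightarrow>
       ln (cmod (f z)) = (\<Sum>a\<in>divisor_upto R. of_int (zorder f a) * ln (cmod (blaschke R a z))) + Re (h z)"
    "\<And>t. ln (cmod (f (of_real R * cis t))) = Re (h (of_real R * cis t))"
    by (rule ln_factorization[OF reg]) (rule that; assumption)
    \<comment> \<open>This is \<open>f z / z^n\<close> read off from the factorization; the Blaschke
      factor of the origin is \<open>z / R\<close>, which explains the power of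
      \<open>R\<close>.\<close>
    define v where "v = (\<lambda>z. of_real R powi (-n) * (\<Prod>a\<in>D. blaschke R a z powi zorder f a) * exp (h z))"
    have split: "(\<Prod>a\<in>divisor_upto R. blaschke R a z powi zorder f a) =
        (z / of_real R) powi n * (\<Prod>a\<in>D. blaschke R a z powi zorder f a)" for z
    proof (cases "f 0 = 0")
      case True
      then have "0 \<in> divisor_upto R" using R by (simp add: divisor_upto_def)
      moreover have "blaschke R 0 z = z / of_real R"
        using R by (simp add: blaschke_def power2_eq_square)
      ultimately show ?thesis
        using prod.remove[OF finite_divisor_upto, of 0 R "\<lambda>a. blaschke R a z powi zorder f a"]
        by (simp add: D_def n_def)
    next
      case False
      then have "divisor_upto R - {0} = divisor_upto R" "n = 0"
        using zero_iff_zorder[of 0] by (auto simp: divisor_upto_def n_def)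
      then show ?thesis by (simp add: D_def)
    qed
    have "eventually (\<lambda>z. z \<in> ball 0 (min r R) - {0}) (at (0::complex))"
      using u(2) R by (intro eventually_at_in_open) auto
    \<comment> \<open>The two expressions agree only on a punctured disc, as \<open>f 0\<close> may
      be the conventional value 0 at a pole. Continuity of both carries the equality to 0.\<close>
    then have ev: "eventually (\<lambda>z. u z = v z) (at 0)"
      using eventually_nonzero[of 0]
    proof eventually_elim
      case (elim z)
      then have z: "z \<noteq> 0" "cmod z \<le> R" "z \<in> cball 0 r - {0}" by auto
      have "u z * z powi n = (z / of_real R) powi n * (\<Prod>a\<in>D. blaschke R a z powi zorder f a) * exp (h z)"
        using u(4)[OF z(3)] h(3)[OF z(2) elim(2)] split[of z] by simp
      also have "\<dots> = v z * z powi n"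
        using z R by (simp add: v_def power_int_mult_distrib power_int_inverse power_int_minus divide_inverse mult_ac)
      finally show "u z = v z" using z by (simp add: power_int_eq_0_iff)
    qed
    have "isCont h 0"
      using h(2) R by (intro continuous_on_interior[OF h(1)]) auto
    then have "isCont v 0"
      unfolding v_def blaschke_def using D R by (intro continuous_intros) (auto simp: blaschke_def)
    then have "v \<midarrow>0\<rightarrow> v 0" by (simp add: isCont_def)
    then have "u \<midarrow>0\<rightarrow> v 0" using tendsto_cong[OF ev] by simp
    then have "u 0 = v 0" using u_cont LIM_unique by blast
    moreover have "cmod (v 0) = R powi (-n) * (\<Prod>a\<in>D. (cmod a / R) powi zorder f a) * exp (Re (h 0))"
    proof -
      have "cmod (blaschke R a 0) = cmod a / R" for a
        using R by (simp add: blaschke_def norm_mult norm_divide power2_eq_square)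
      then show ?thesis
        using R by (simp add: v_def norm_mult prod_norm[symmetric] norm_power_int)
    qed
    moreover have "ln (R powi (-n) * (\<Prod>a\<in>D. (cmod a / R) powi zorder f a) * exp (Re (h 0))) =
       - of_int n * ln R - (\<Sum>a\<in>D. of_int (zorder f a) * ln (R / cmod a)) + Re (h 0)"
    proof -
      have p: "(\<Prod>a\<in>D. (cmod a / R) powi zorder f a) > 0"
        using D R by (intro prod_pos) auto
      have "ln (\<Prod>a\<in>D. (cmod a / R) powi zorder f a) = (\<Sum>a\<in>D. ln ((cmod a / R) powi zorder f a))"
        using D R by (intro ln_prod finD) auto
      also have "\<dots> = (\<Sum>a\<in>D. - (of_int (zorder f a) * ln (R / cmod a)))"
        using D R by (intro sum.cong refl) (simp add: ln_power_int ln_div algebra_simps)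
      finally show ?thesis
        using p R by (simp add: ln_mult ln_power_int sum_negf)
    qed
    ultimately have "Re (h 0) = ln (cmod (u 0)) + (\<Sum>a\<in>D. of_int (zorder f a) * ln (R / cmod a)) + of_int n * ln R"
      by simp
    then show "((\<lambda>t. ln (cmod (f (of_real R * cis t)))) has_integral
      (2 * pi * (ln (cmod (u 0)) + (\<Sum>a\<in>divisor_upto R - {0}. of_int (zorder f a) * ln (R / cmod a))
                   + of_int (zorder f 0) * ln R))) {0..2 * pi}"
      using harmonic_mean_value[OF h(1,2) R] unfolding h(5) D_def n_def by simp
  qed
qed

end

section \<open>Counting functions and the characteristic\<close>

text \<open>A pole of modulus \<open>c\<close> enters the integrand of \<open>N(R, f)\<close> as
  \<open>1 / t\<close> from \<open>t = c\<close> onwards.\<close>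

lemma has_integral_recip_tail:
  assumes "0 < c" "c \<le> (R::real)"
  shows "((\<lambda>t. if c \<le> t then 1 / t else 0) has_integral ln (R / c)) {0..R}"
proof -
  have "((\<lambda>t. 1 / t) has_integral (ln R - ln c)) {c..R}"
    using assms by (intro fundamental_theorem_of_calculus)
      (auto intro!: derivative_eq_intros simp: has_real_derivative_iff_has_vector_derivative[symmetric] divide_inverse)
  then have "((\<lambda>t. if t \<in> {c..R} then 1 / t else 0) has_integral (ln R - ln c)) {0..R}"
    by (subst has_integral_restrict) (use assms in auto)
  moreover have "(\<lambda>t. if t \<in> {c..R} then 1 / t else 0) t = (if c \<le> t then 1 / t else 0)" if "t \<in> {0..R}" for t
    using that by auto
  ultimately have "((\<lambda>t. if c \<le> t then 1 / t else 0) has_integral (ln R - ln c)) {0..R}"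
    by (rule has_integral_eq[rotated])
  then show ?thesis using assms by (simp add: ln_div)
qed

context plane_meromorphic
begin

lemma divisor_upto_0: "(\<Sum>a\<in>divisor_upto 0. g a) = (if f 0 = 0 then g 0 else (0::'b::comm_monoid_add))"
proof -
  have "divisor_upto 0 = (if f 0 = 0 then {0} else {})" by (auto simp: divisor_upto_def)
  then show ?thesis by simp
qed

lemma integrated_count_eq:
  assumes R: "R > 0"
  shows "integrated_count R f = (\<Sum>a\<in>divisor_upto R - {0}. real (nat (- zorder f a)) * ln (R / cmod a))
           + real (nat (- zorder f 0)) * ln R"
proof -
  define D where "D = divisor_upto R - {0}"
  have finD: "finite D" by (simp add: D_def finite_divisor_upto)
  have c0: "pole_count 0 f = nat (- zorder f 0)"
    using zero_iff_zorder[of 0] by (auto simp: pole_count_eq divisor_upto_0)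
  have "((\<lambda>t. \<Sum>a\<in>D. real (nat (- zorder f a)) * (if cmod a \<le> t then 1 / t else 0)) has_integral
          (\<Sum>a\<in>D. real (nat (- zorder f a)) * ln (R / cmod a))) {0..R}"
    using finD
    by (intro has_integral_sum has_integral_mult_right has_integral_recip_tail) (auto simp: D_def divisor_upto_def)
  moreover have "(\<Sum>a\<in>D. real (nat (- zorder f a)) * (if cmod a \<le> t then 1 / t else 0)) =
      (real (pole_count t f) - real (pole_count 0 f)) / t" if t: "t \<in> {0..R}" for t
  proof (cases "t = 0")
    case False
    have "divisor_upto t - {0} = {a\<in>D. cmod a \<le> t}"
      using t by (auto simp: D_def divisor_upto_def)
    moreover have "pole_count t f = nat (- zorder f 0) + (\<Sum>a\<in>divisor_upto t - {0}. nat (- zorder f a))"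
    proof (cases "f 0 = 0")
      case True
      then show ?thesis unfolding pole_count_eq using t
        by (intro sum.remove finite_divisor_upto) (auto simp: divisor_upto_def)
    next
      case False
      then have "divisor_upto t - {0} = divisor_upto t" by (auto simp: divisor_upto_def)
      then show ?thesis using False zero_iff_zorder[of 0] by (simp add: pole_count_eq)
    qed
    ultimately have "real (pole_count t f) - real (pole_count 0 f) = (\<Sum>a\<in>{a\<in>D. cmod a \<le> t}. real (nat (- zorder f a)))"
      by (simp add: c0)
    also have "\<dots> = (\<Sum>a\<in>D. if cmod a \<le> t then real (nat (- zorder f a)) else 0)"
      by (rule sum.inter_filter[OF finD])
    finally show ?thesis
      by (simp add: sum_divide_distrib) (intro sum.cong, auto)
  \<comment> \<open>At \<open>t = 0\<close> both sides are 0, by \<open>x / 0 = 0\<close>.\<close>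
  qed (auto simp: D_def intro!: sum.neutral)
  ultimately have "((\<lambda>t. (real (pole_count t f) - real (pole_count 0 f)) / t) has_integral
          (\<Sum>a\<in>D. real (nat (- zorder f a)) * ln (R / cmod a))) {0..R}"
    by (rule has_integral_eq[rotated])
  then show ?thesis
    by (simp add: integrated_count_def integral_unique c0 D_def)
qed

text \<open>This is \<open>N(R, 1/f)\<close>, written directly in its summed form.\<close>

definition zero_integrated_count :: "real \<Rightarrow> real" where
  "zero_integrated_count R = (\<Sum>a\<in>divisor_upto R - {0}. real (nat (zorder f a)) * ln (R / cmod a))
     + real (nat (zorder f 0)) * ln R"

lemma counts_nonneg:
  assumes "R \<ge> 1"
  shows "zero_integrated_count R \<ge> 0" "integrated_count R f \<ge> 0"
proof -
  have "ln (R / cmod a) \<ge> 0" if "a \<in> divisor_upto R - {0}" for a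
    using that assms by (intro ln_ge_zero) (auto simp: divisor_upto_def field_simps)
  then have "(\<Sum>a\<in>divisor_upto R - {0}. real (nat (zorder f a)) * ln (R / cmod a)) \<ge> 0"
      "(\<Sum>a\<in>divisor_upto R - {0}. real (nat (- zorder f a)) * ln (R / cmod a)) \<ge> 0"
    by (auto intro!: sum_nonneg mult_nonneg_nonneg)
  then show "zero_integrated_count R \<ge> 0" "integrated_count R f \<ge> 0"
    using assms by (simp_all add: zero_integrated_count_def integrated_count_eq)
qed

definition mean_log :: "real \<Rightarrow> real" where
  "mean_log R = 1 / (2 * pi) * integral {0..2 * pi} (\<lambda>t. ln (cmod (f (of_real R * cis t))))"

text \<open>Splitting each order into positive and negative part turns the sum in Jensen's formula
  into \<open>N(R, 1/f) - N(R, f)\<close>.\<close>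

lemma jensen_counts:
  obtains K where "\<And>R. regular_radius R \<Longrightarrow> mean_log R = K + zero_integrated_count R - integrated_count R f"
proof -
  obtain K where K: "\<And>R. regular_radius R \<Longrightarrow>
    ((\<lambda>t. ln (cmod (f (of_real R * cis t)))) has_integral
      (2 * pi * (K + (\<Sum>a\<in>divisor_upto R - {0}. of_int (zorder f a) * ln (R / cmod a))
                   + of_int (zorder f 0) * ln R))) {0..2 * pi}"
    using jensen by blast
  have split: "real_of_int k = real (nat k) - real (nat (- k))" for k by auto
  show thesis
  proof (rule that[of K])
    fix R assume R: "regular_radius R"
    then have "R > 0" by (simp add: regular_radius_def)
    have "mean_log R = K + (\<Sum>a\<in>divisor_upto R - {0}. of_int (zorder f a) * ln (R / cmod a))
                   + of_int (zorder f 0) * ln R"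
      using integral_unique[OF K[OF R]] by (simp add: mean_log_def)
    also have "\<dots> = K + zero_integrated_count R - integrated_count R f"
      unfolding zero_integrated_count_def integrated_count_eq[OF \<open>R > 0\<close>] split
      by (simp add: left_diff_distrib sum_subtractf)
    finally show "mean_log R = K + zero_integrated_count R - integrated_count R f" .
  qed
qed

lemma mean_abs_log_eq:
  assumes "regular_radius R"
  shows "mean_abs_log R = 2 * proximity R f - mean_log R" "mean_log R \<le> proximity R f" "proximity R f \<ge> 0"
proof -
  let ?g = "\<lambda>t. ln (cmod (f (of_real R * cis t)))"
  have cont: "continuous_on {0..2*pi} ?g" using continuous_ln_circle[OF assms] .
  have prox: "proximity R f = 1 / (2 * pi) * integral {0..2*pi} (\<lambda>t. max 0 (?g t))"
    by (simp add: proximity_def log_plus_def cis_conv_exp)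
  have i1: "(\<lambda>t. max 0 (?g t)) integrable_on {0..2*pi}" "?g integrable_on {0..2*pi}"
    by (intro integrable_continuous_interval continuous_intros cont)+
  have "integral {0..2*pi} (\<lambda>t. \<bar>?g t\<bar>) = integral {0..2*pi} (\<lambda>t. 2 * max 0 (?g t) - ?g t)"
    by (intro integral_cong) auto
  also have "\<dots> = 2 * integral {0..2*pi} (\<lambda>t. max 0 (?g t)) - integral {0..2*pi} ?g"
    using i1 by (simp add: integral_diff integrable_on_cmult_left)
  finally show "mean_abs_log R = 2 * proximity R f - mean_log R"
    unfolding mean_abs_log_def mean_log_def prox by (simp add: right_diff_distrib)
  have "integral {0..2*pi} ?g \<le> integral {0..2*pi} (\<lambda>t. max 0 (?g t))"
    by (intro integral_le i1) auto
  then show "mean_log R \<le> proximity R f" unfolding prox mean_log_def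
    by (intro mult_left_mono) auto
  have "integral {0..2*pi} (\<lambda>t. max 0 (?g t)) \<ge> 0"
    by (intro integral_nonneg i1) auto
  then show "proximity R f \<ge> 0" unfolding prox by simp
qed

text \<open>One direction of the first main theorem. The first bound follows from
  \<open>|x| = 2 max 0 x - x\<close> and Jensen's formula on dropping \<open>N(R, 1/f)\<close>, the
  second from \<open>mean_log R <= m(R, f)\<close>. The condition \<open>R >= 1\<close> makes
  \<open>ln R\<close>, the weight of the origin, nonnegative. \<open>K\<close> depends on
  \<open>f\<close>.\<close>

lemma mean_abs_log_bound:
  obtains K where "K \<ge> 0" "\<And>R. regular_radius R \<Longrightarrow> R \<ge> 1 \<Longrightarrow> mean_abs_log R \<le> 2 * nevanlinna_T R f + K"
    "\<And>R. regular_radius R \<Longrightarrow> R \<ge> 1 \<Longrightarrow> zero_integrated_count R \<le> nevanlinna_T R f + K"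
proof -
  obtain K where K: "\<And>R. regular_radius R \<Longrightarrow> mean_log R = K + zero_integrated_count R - integrated_count R f"
    using jensen_counts by blast
  obtain k where k: "k \<ge> 0" "K \<le> k" "- K \<le> k" using that[of "\<bar>K\<bar>"] by auto
  show thesis
  proof (rule that[of k])
    fix R assume R: "regular_radius R" "R \<ge> 1"
    note facts = k mean_abs_log_eq[OF R(1)] K[OF R(1)] counts_nonneg[OF R(2)]
    show "mean_abs_log R \<le> 2 * nevanlinna_T R f + k"
      unfolding nevanlinna_T_def using facts by (simp add: algebra_simps)
    show "zero_integrated_count R \<le> nevanlinna_T R f + k"
      unfolding nevanlinna_T_def using facts by linarith
  qed (rule k(1))
qed

lemma nevanlinna_T_bounds:
  assumes "regular_radius R" "R \<ge> 1"
  shows "nevanlinna_T R f \<ge> 0" "integrated_count R f \<le> nevanlinna_T R f"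
  using mean_abs_log_eq[OF assms(1)] counts_nonneg[OF assms(2)] by (simp_all add: nevanlinna_T_def)

text \<open>A point with \<open>0 < |a| <= \<rho>\<close> contributes
  \<open>ln (R / |a|) >= ln (R / \<rho>)\<close> per multiplicity; the origin contributes
  \<open>ln R\<close>, which is enough because \<open>\<rho> >= 1\<close>.\<close>

lemma zero_pole_count_le_integrated:
  assumes "1 \<le> \<rho>" "\<rho> < R"
  shows "real (zero_pole_count \<rho> f) * ln (R / \<rho>) \<le> zero_integrated_count R + integrated_count R f"
proof -
  have R: "R > 0" "R \<ge> 1" using assms by auto
  have mult: "real (ord_at a) = real (nat (zorder f a)) + real (nat (- zorder f a))" for a
    by (simp add: ord_at_def)
  have eq: "zero_integrated_count R + integrated_count R f =
     (\<Sum>a\<in>divisor_upto R - {0}. real (ord_at a) * ln (R / cmod a)) + real (ord_at 0) * ln R"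
    unfolding zero_integrated_count_def integrated_count_eq[OF R(1)] mult
    by (simp add: sum.distrib distrib_right)
  have m0: "ord_at 0 = 0" if "f 0 \<noteq> 0" using that zero_iff_zorder[of 0] by (simp add: ord_at_def)
  have "zero_pole_count \<rho> f = (\<Sum>a\<in>divisor_upto \<rho> - {0}. ord_at a) + ord_at 0"
  proof (cases "f 0 = 0")
    case True
    then have "0 \<in> divisor_upto \<rho>" using assms by (simp add: divisor_upto_def)
    then show ?thesis unfolding zero_pole_count_eq
      by (subst sum.remove[of _ 0]) (auto simp: finite_divisor_upto)
  next
    case False
    then have "divisor_upto \<rho> - {0} = divisor_upto \<rho>" by (auto simp: divisor_upto_def)
    then show ?thesis using m0[OF False] by (simp add: zero_pole_count_eq)
  qed
  then have "real (zero_pole_count \<rho> f) * ln (R / \<rho>) =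
     (\<Sum>a\<in>divisor_upto \<rho> - {0}. real (ord_at a) * ln (R / \<rho>)) + real (ord_at 0) * ln (R / \<rho>)"
    by (simp add: distrib_right sum_distrib_right)
  also have "(\<Sum>a\<in>divisor_upto \<rho> - {0}. real (ord_at a) * ln (R / \<rho>)) \<le>
      (\<Sum>a\<in>divisor_upto \<rho> - {0}. real (ord_at a) * ln (R / cmod a))"
    using assms R by (intro sum_mono mult_left_mono) (auto simp: divisor_upto_def intro!: divide_left_mono)
  also have "\<dots> \<le> (\<Sum>a\<in>divisor_upto R - {0}. real (ord_at a) * ln (R / cmod a))"
    using assms R
    by (intro sum_mono2 mult_nonneg_nonneg ln_ge_zero)
       (auto simp: divisor_upto_def field_simps intro: finite_subset[OF _ finite_divisor_upto[of R]])
  also have "real (ord_at 0) * ln (R / \<rho>) \<le> real (ord_at 0) * ln R"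
    using assms R by (intro mult_left_mono) (auto simp: field_simps)
  finally show ?thesis using eq by simp
qed

end

section \<open>Unboundedness of the characteristic and the pointwise shift bound\<close>

lemma abs_ln_diff_le:
  fixes x y :: real
  assumes "m > 0" "m \<le> x" "m \<le> y" "\<bar>x - y\<bar> \<le> d"
  shows "\<bar>ln x - ln y\<bar> \<le> d / m"
proof -
  have *: "ln u - ln v \<le> d / m" if "m \<le> u" "m \<le> v" "\<bar>u - v\<bar> \<le> d" for u v :: real
  proof -
    have "ln u - ln v = ln (u / v)" using that assms(1) by (subst ln_div) auto
    also have "\<dots> \<le> u / v - 1" using that assms(1) by (intro ln_le_minus_one) auto
    also have "\<dots> = (u - v) / v" using that assms(1) by (simp add: diff_divide_distrib)
    also have "\<dots> \<le> d / v" using that assms(1) by (intro divide_right_mono) auto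
    also have "\<dots> \<le> d / m" using that assms(1) by (intro divide_left_mono mult_pos_pos) auto
    finally show ?thesis .
  qed
  show ?thesis using *[of x y] *[of y x] assms by (simp add: abs_le_iff abs_minus_commute)
qed

context plane_meromorphic
begin

text \<open>This lets \<open>T\<close> absorb the constants that depend on \<open>f\<close>. One
  zero or pole already forces logarithmic growth of the counting functions. Without any, the
  Blaschke sum is empty, and \<open>T\<close> bounded along a sequence of radii would make the
  Schwarz bound tend to 0; then \<open>|f|\<close> is constant and Liouville's theorem
  applies.\<close>

lemma nevanlinna_T_unbounded:
  assumes nonconst: "\<nexists>c. \<forall>z. f z = c"
  shows "eventually (\<lambda>R. regular_radius R \<longrightarrow> C \<le> nevanlinna_T R f) at_top"
proof -
  obtain K where K: "K \<ge> 0" "\<And>R. regular_radius R \<Longrightarrow> R \<ge> 1 \<Longrightarrow> mean_abs_log R \<le> 2 * nevanlinna_T R f + K"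
    "\<And>R. regular_radius R \<Longrightarrow> R \<ge> 1 \<Longrightarrow> zero_integrated_count R \<le> nevanlinna_T R f + K"
    by (rule mean_abs_log_bound) blast
  show ?thesis
  proof (cases "\<exists>a. f a = 0")
    case True
    then obtain a where a: "f a = 0" by blast
    define \<rho> where "\<rho> = max 1 (cmod a)"
    have \<rho>: "\<rho> \<ge> 1" "a \<in> divisor_upto \<rho>" using a by (auto simp: \<rho>_def divisor_upto_def)
    have "1 \<le> ord_at a" using a zero_iff_zorder[of a] by (simp add: ord_at_def)
    also have "ord_at a \<le> zero_pole_count \<rho> f"
      unfolding zero_pole_count_eq using \<rho> by (intro member_le_sum finite_divisor_upto) auto
    finally have n: "real (zero_pole_count \<rho> f) \<ge> 1" by simp
    have "eventually (\<lambda>R. R > \<rho>) at_top" "eventually (\<lambda>R. R \<ge> \<rho> * exp (2 * C + K)) at_top"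
      by (rule eventually_gt_at_top eventually_ge_at_top)+
    then show ?thesis
    proof eventually_elim
      case (elim R)
      show ?case
      proof
        assume reg: "regular_radius R"
        have R: "R \<ge> 1" using elim \<rho> by simp
        have "exp (2 * C + K) \<le> R / \<rho>" using elim \<rho> by (simp add: field_simps)
        then have l: "2 * C + K \<le> ln (R / \<rho>)" using elim \<rho> by (subst ln_ge_iff) auto
        have "0 \<le> ln (R / \<rho>)" using elim \<rho> by (intro ln_ge_zero) (auto simp: field_simps)
        then have "ln (R / \<rho>) \<le> real (zero_pole_count \<rho> f) * ln (R / \<rho>)"
          using n mult_right_mono[OF n, of "ln (R / \<rho>)"] by simp
        also have "\<dots> \<le> zero_integrated_count R + integrated_count R f"
          using zero_pole_count_le_integrated \<rho> elim by simp
        also have "\<dots> \<le> 2 * nevanlinna_T R f + K"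
          using K(3)[OF reg R] nevanlinna_T_bounds(2)[OF reg R] by simp
        finally show "C \<le> nevanlinna_T R f" using l by simp
      qed
    qed
  next
    case False
    then have nz: "f z \<noteq> 0" for z by blast
    have reg: "regular_radius R" if "R > 0" for R using that nz by (simp add: regular_radius_def)
    have emp: "divisor_upto R = {}" for R using nz by (auto simp: divisor_upto_def)
    show ?thesis
    proof (rule ccontr)
      assume "\<not> ?thesis"
      then have fr: "\<exists>R\<ge>R0. nevanlinna_T R f < C" for R0
        unfolding eventually_at_top_linorder by (auto simp: not_le)
      have eq: "cmod (f w) = cmod (f 0)" for w
      proof -
        have "\<bar>ln (cmod (f w / f 0))\<bar> \<le> 0 + e" if e: "e > 0" for e :: real
        proof -
          \<comment> \<open>The bound below comes out as \<open>M / (R - cmod w)\<close>, hence the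
            size demanded of \<open>R\<close>.\<close>
          define M where "M = 2 * cmod w * (2 * \<bar>C\<bar> + K)"
          obtain R where R: "R \<ge> cmod w + 1 + M / e" "nevanlinna_T R f < C" using fr by blast
          have M: "M \<ge> 0" "M / e \<ge> 0" using K(1) e by (auto simp: M_def)
          have R': "R \<ge> 1" "cmod w < R" "R - cmod w \<ge> 1" "R - cmod w \<ge> M / e"
            using R(1) M norm_ge_zero[of w] by linarith+
          have "\<bar>ln (cmod (f w / f 0))\<bar> \<le>
             2 * R * cmod (w - 0) / ((R - cmod w) * (R - cmod 0)) * mean_abs_log R"
            using log_ratio_bound[of R 0 w] reg[of R] R' nz by (simp add: emp)
          also have "2 * R * cmod (w - 0) / ((R - cmod w) * (R - cmod 0)) = 2 * cmod w / (R - cmod w)"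
            using R' by (simp add: field_simps)
          also have "2 * cmod w / (R - cmod w) * mean_abs_log R \<le> 2 * cmod w / (R - cmod w) * (2 * \<bar>C\<bar> + K)"
            using K(2)[of R] reg[of R] R' R(2) by (intro mult_left_mono) auto
          also have "\<dots> = M / (R - cmod w)" by (simp add: M_def)
          also have "\<dots> \<le> e" using R' e by (simp add: field_simps)
          finally show ?thesis by simp
        qed
        then have "\<bar>ln (cmod (f w / f 0))\<bar> \<le> 0" by (rule field_le_epsilon)
        then have "ln (cmod (f w / f 0)) = 0" by simp
        then have "cmod (f w / f 0) = 1" using nz by (subst (asm) ln_eq_zero_iff) auto
        then show ?thesis using nz by (simp add: norm_divide field_simps)
      qed
      have "f analytic_on UNIV"
        using nicely_meromorphic_without_singularities[OF nice] nz is_pole_zero_at_nicely_mero[OF nice] by blast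
      then have "f holomorphic_on UNIV" by (rule analytic_imp_holomorphic)
      moreover have "bounded (range f)" unfolding bounded_iff by (auto intro: eq[THEN eq_refl])
      ultimately have "f constant_on UNIV" by (rule Liouville_theorem)
      then show False using nonconst by (auto simp: constant_on_def)
    qed
  qed
qed

text \<open>For \<open>|z| = r\<close> the two fractions are upper bounds of
  \<open>1 / |z - a|\<close> and of \<open>1 / |z + \<eta> - a| = 1 / |z - (a - \<eta>)|\<close>.
  The cutoff \<open>\<beta> r\<close> keeps the points that can come near \<open>z\<close> or
  \<open>z + \<eta>\<close>.\<close>

definition close_sum :: "complex \<Rightarrow> real \<Rightarrow> real \<Rightarrow> real" where
  "close_sum \<eta> \<beta> r = (\<Sum>a\<in>divisor_upto (\<beta> * r). real (ord_at a) * (1 / \<bar>r - cmod a\<bar> + 1 / \<bar>r - cmod (a - \<eta>)\<bar>))"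

text \<open>The smallness of \<open>\<eta>\<close> relative to \<open>r\<close> gives
  \<open>|z + \<eta>| <= (1 + \<beta>) r / 2\<close>, so \<open>z + \<eta>\<close> stays at distance
  at least \<open>(\<gamma> - 1) r / 2\<close> from the circle \<open>|u| = \<gamma> r\<close> and
  at least \<open>(\<beta> - 1) r / 2\<close> from every \<open>a\<close> with
  \<open>|a| > \<beta> r\<close>. The condition \<open>avoid\<close> keeps the denominators of
  \<open>close_sum\<close> nonzero; under \<open>x / 0 = 0\<close> the dangerous summand would
  otherwise vanish.\<close>

lemma log_shift_bound:
  assumes "1 < \<beta>" "\<beta> < \<gamma>" and z: "cmod z = r" and r: "r > 0"
    and \<eta>: "cmod \<eta> \<le> (\<beta> - 1) * r / 2"
    and reg: "regular_radius (\<gamma> * r)"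
    and avoid: "\<And>a. f a = 0 \<Longrightarrow> cmod a \<noteq> r" "\<And>a. f a = 0 \<Longrightarrow> cmod (a - \<eta>) \<noteq> r"
  shows "\<bar>ln (cmod (f (z + \<eta>) / f z))\<bar> \<le>
    cmod \<eta> * (4 * \<gamma> / (\<gamma> - 1)\<^sup>2 * mean_abs_log (\<gamma> * r) / r +
      (2 / (\<gamma> - 1) + 3 / (\<beta> - 1)) * real (zero_pole_count (\<gamma> * r) f) / r + close_sum \<eta> \<beta> r)"
proof -
  define R where "R = \<gamma> * r"
  define w where "w = z + \<eta>"
  have fz: "f z \<noteq> 0" using avoid(1) z by blast
  have fw: "f w \<noteq> 0" using avoid(2)[of w] z by (auto simp: w_def)
  have R: "R > 0" "r < R" using assms by (auto simp: R_def)
  have le: "(\<beta> - 1) * r \<le> (\<gamma> - 1) * r" using assms by (intro mult_right_mono) auto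
  have wr: "cmod w \<le> r + (\<beta> - 1) * r / 2"
    using norm_triangle_ineq[of z \<eta>] \<eta> z by (simp add: w_def)
  have Rr: "R - r = (\<gamma> - 1) * r" by (simp add: R_def algebra_simps)
  have Rw: "R - cmod w \<ge> (\<gamma> - 1) * r / 2" using wr Rr le by linarith
  have pos: "(\<gamma> - 1) * r > 0" using assms by simp
  have wR: "cmod w < R" using Rw pos by linarith
  have wz: "w - z = \<eta>" by (simp add: w_def)
  have M0: "mean_abs_log R \<ge> 0"
    unfolding mean_abs_log_def
    by (intro mult_nonneg_nonneg integral_nonneg integrable_continuous_interval continuous_intros
          continuous_ln_circle) (use reg in \<open>auto simp: R_def\<close>)
  have first: "2 * R * cmod (w - z) / ((R - cmod w) * (R - cmod z)) * mean_abs_log R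
      \<le> cmod \<eta> * (4 * \<gamma> / (\<gamma> - 1)\<^sup>2 * mean_abs_log R / r)"
  proof -
    have "2 * R * cmod \<eta> / ((R - cmod w) * (R - r)) \<le> 2 * R * cmod \<eta> / ((\<gamma> - 1) * r / 2 * ((\<gamma> - 1) * r))"
      unfolding Rr using Rw pos R wR assms by (intro divide_left_mono mult_right_mono mult_pos_pos mult_nonneg_nonneg) auto
    also have "\<dots> = cmod \<eta> * (4 * \<gamma> / (\<gamma> - 1)\<^sup>2 / r)"
    proof -
      have "2 * (\<gamma> * r) * e / (g * r / 2 * (g * r)) = e * (4 * \<gamma> / g\<^sup>2 / r)" if "g \<noteq> 0" for g e :: real
        using that r by (simp add: power2_eq_square field_simps)
      from this[of "\<gamma> - 1"] show ?thesis using assms by (simp add: R_def)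
    qed
    finally have "2 * R * cmod \<eta> / ((R - cmod w) * (R - r)) * mean_abs_log R
        \<le> cmod \<eta> * (4 * \<gamma> / (\<gamma> - 1)\<^sup>2 / r) * mean_abs_log R"
      using M0 by (intro mult_right_mono)
    then show ?thesis using wz z by (simp add: mult_ac)
  qed
  define D where "D = divisor_upto R"
  define q where "q = (\<lambda>a. if cmod a \<le> \<beta> * r then 1 / \<bar>r - cmod a\<bar> + 1 / \<bar>r - cmod (a - \<eta>)\<bar> else 0)"
  have each: "\<bar>ln (cmod (blaschke R a w)) - ln (cmod (blaschke R a z))\<bar> \<le>
      cmod \<eta> * ((2 / (\<gamma> - 1) + 3 / (\<beta> - 1)) / r + q a)" if a: "a \<in> D" for a
  proof -
    have fa: "f a = 0" and aR: "cmod a \<le> R" using a by (auto simp: D_def divisor_upto_def)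
    have aR': "cmod a < R" using divisor_upto_less[OF reg] a by (simp add: D_def R_def)
    have za: "z \<noteq> a" "w \<noteq> a" using fz fw fa by auto
    \<comment> \<open>Numerator and denominator of the Blaschke factor without the constant
      \<open>R\<close>. \<open>P\<close> may be small near \<open>a\<close>, whereas
      \<open>Q\<close> is at least of order \<open>R r\<close>.\<close>
    define P Q where "P = (\<lambda>u. cmod (u - a))" and "Q = (\<lambda>u. cmod (of_real (R\<^sup>2) - cnj a * u))"
    have Qge: "Q u \<ge> R * ((\<gamma> - 1) * r / 2)" if "R - cmod u \<ge> (\<gamma> - 1) * r / 2" "cmod u \<le> R" for u
    proof -
      have "cmod (of_real (R\<^sup>2)) - cmod (cnj a * u) \<le> Q u" unfolding Q_def by (rule norm_triangle_ineq2)
      moreover have "cmod (of_real (R\<^sup>2)) = R * R" by (simp only: norm_of_real) (simp add: power2_eq_square)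
      moreover have "cmod (cnj a * u) \<le> R * cmod u"
        using aR by (simp add: norm_mult mult_right_mono)
      ultimately have "R * (R - cmod u) \<le> Q u" by (simp add: algebra_simps)
      moreover have "R * ((\<gamma> - 1) * r / 2) \<le> R * (R - cmod u)"
        using that R by (intro mult_left_mono) auto
      ultimately show ?thesis by linarith
    qed
    have Qw: "Q w \<ge> R * ((\<gamma> - 1) * r / 2)" using Rw wR by (intro Qge) auto
    have Qz: "Q z \<ge> R * ((\<gamma> - 1) * r / 2)" 
    proof (rule Qge)
      show "(\<gamma> - 1) * r / 2 \<le> R - cmod z" unfolding z using Rr pos by linarith
    qed (use z R in simp)
    have Qpos: "R * ((\<gamma> - 1) * r / 2) > 0" using R pos by simp
    have "\<bar>Q w - Q z\<bar> \<le> cmod ((of_real (R\<^sup>2) - cnj a * w) - (of_real (R\<^sup>2) - cnj a * z))"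
      unfolding Q_def by (rule norm_triangle_ineq3)
    also have "(of_real (R\<^sup>2) - cnj a * w) - (of_real (R\<^sup>2) - cnj a * z) = - (cnj a * \<eta>)"
      by (simp add: w_def algebra_simps)
    also have "cmod \<dots> = cmod a * cmod \<eta>" by (simp add: norm_mult)
    also have "\<dots> \<le> R * cmod \<eta>" using aR by (intro mult_right_mono) auto
    finally have "\<bar>ln (Q w) - ln (Q z)\<bar> \<le> R * cmod \<eta> / (R * ((\<gamma> - 1) * r / 2))"
      by (rule abs_ln_diff_le[OF Qpos Qw Qz])
    also have "\<dots> = cmod \<eta> * (2 / (\<gamma> - 1) / r)" using R by simp
    finally have Qb: "\<bar>ln (Q w) - ln (Q z)\<bar> \<le> cmod \<eta> * (2 / (\<gamma> - 1) / r)" .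
    have Ppos: "P w > 0" "P z > 0" using za by (auto simp: P_def)
    have "\<bar>P w - P z\<bar> \<le> cmod ((w - a) - (z - a))" unfolding P_def by (rule norm_triangle_ineq3)
    also have "(w - a) - (z - a) = \<eta>" by (simp add: w_def)
    finally have "\<bar>ln (P w) - ln (P z)\<bar> \<le> cmod \<eta> / min (P w) (P z)"
      using Ppos by (intro abs_ln_diff_le) auto
    also have "\<dots> = cmod \<eta> * (1 / min (P w) (P z))" by simp
    also have "1 / min (P w) (P z) \<le> 1 / P z + 1 / P w"
      using Ppos by (auto simp: min_def)
    also have "1 / P z + 1 / P w \<le> 3 / (\<beta> - 1) / r + q a"
    proof (cases "cmod a \<le> \<beta> * r")
      case True
      have "\<bar>r - cmod a\<bar> \<le> P z"
        unfolding P_def using norm_triangle_ineq3[of z a] z by simp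
      moreover have "\<bar>r - cmod (a - \<eta>)\<bar> \<le> P w"
        unfolding P_def w_def using norm_triangle_ineq3[of z "a - \<eta>"] z by (simp add: algebra_simps)
      moreover have "\<bar>r - cmod a\<bar> > 0" "\<bar>r - cmod (a - \<eta>)\<bar> > 0"
        using avoid[of a] fa by auto
      ultimately have "1 / P z + 1 / P w \<le> 1 / \<bar>r - cmod a\<bar> + 1 / \<bar>r - cmod (a - \<eta>)\<bar>"
        using Ppos by (intro add_mono divide_left_mono mult_pos_pos) auto
      moreover have "3 / (\<beta> - 1) / r \<ge> 0" using assms by simp
      moreover have "q a = 1 / \<bar>r - cmod a\<bar> + 1 / \<bar>r - cmod (a - \<eta>)\<bar>"
        using True by (simp add: q_def)
      ultimately show ?thesis by linarith
    next
      case False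
      have "P z \<ge> cmod a - cmod z" unfolding P_def using norm_triangle_ineq2[of a z] by (simp add: norm_minus_commute)
      then have Pz: "P z \<ge> (\<beta> - 1) * r" using False z by (simp add: algebra_simps)
      have "P w \<ge> cmod a - cmod w" unfolding P_def using norm_triangle_ineq2[of a w] by (simp add: norm_minus_commute)
      moreover have "(\<beta> - 1) * r = \<beta> * r - r" by (simp add: algebra_simps)
      ultimately have Pw: "P w \<ge> (\<beta> - 1) * r / 2" using False wr by linarith
      have b: "(\<beta> - 1) * r > 0" using assms by simp
      \<comment> \<open>The 3 in \<open>3 / (\<beta> - 1)\<close> is 1 for \<open>z\<close> plus 2
        for \<open>w\<close>, whose distance from \<open>a\<close> is guaranteed only half as
        large.\<close>
      have "1 / P z + 1 / P w \<le> 1 / ((\<beta> - 1) * r) + 1 / ((\<beta> - 1) * r / 2)"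
        using Pz Pw b Ppos assms by (intro add_mono divide_left_mono mult_pos_pos) auto
      also have "\<dots> = 3 / (\<beta> - 1) / r" using b by (simp add: field_simps)
      finally show ?thesis using False by (simp add: q_def)
    qed
    finally have Pb: "\<bar>ln (P w) - ln (P z)\<bar> \<le> cmod \<eta> * (3 / (\<beta> - 1) / r + q a)"
      by (simp add: mult_left_mono)
    have lb: "ln (cmod (blaschke R a u)) = ln R + ln (P u) - ln (Q u)" if "P u > 0" "Q u > 0" for u
      using that R by (simp add: blaschke_def norm_mult norm_divide ln_mult_pos ln_div P_def Q_def)
    have "Q w > 0" "Q z > 0" using Qw Qz Qpos by linarith+
    then have "\<bar>ln (cmod (blaschke R a w)) - ln (cmod (blaschke R a z))\<bar> =
        \<bar>(ln (P w) - ln (P z)) - (ln (Q w) - ln (Q z))\<bar>"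
      using Ppos by (simp add: lb)
    also have "\<dots> \<le> cmod \<eta> * (3 / (\<beta> - 1) / r + q a) + cmod \<eta> * (2 / (\<gamma> - 1) / r)"
      using Pb Qb by linarith
    also have "\<dots> = cmod \<eta> * ((2 / (\<gamma> - 1) + 3 / (\<beta> - 1)) / r + q a)"
      by (simp add: algebra_simps add_divide_distrib)
    finally show ?thesis .
  qed
  have "(\<Sum>a\<in>D. real (ord_at a) * \<bar>ln (cmod (blaschke R a w)) - ln (cmod (blaschke R a z))\<bar>)
     \<le> (\<Sum>a\<in>D. real (ord_at a) * (cmod \<eta> * ((2 / (\<gamma> - 1) + 3 / (\<beta> - 1)) / r + q a)))"
    by (intro sum_mono mult_left_mono each) auto
  also have "\<dots> = cmod \<eta> * ((2 / (\<gamma> - 1) + 3 / (\<beta> - 1)) / r * (\<Sum>a\<in>D. real (ord_at a)) + (\<Sum>a\<in>D. real (ord_at a) * q a))"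
  proof -
    have "(\<Sum>a\<in>D. m a * (e * (c + q a))) = e * (c * (\<Sum>a\<in>D. m a) + (\<Sum>a\<in>D. m a * q a))"
      for m :: "complex \<Rightarrow> real" and c e
      by (simp add: sum_distrib_left sum.distrib[symmetric] algebra_simps)
    then show ?thesis .
  qed
  also have "(\<Sum>a\<in>D. real (ord_at a) * q a) = close_sum \<eta> \<beta> r"
  proof -
    have "\<beta> * r \<le> R" using assms by (simp add: R_def)
    then have "divisor_upto (\<beta> * r) = {a\<in>D. cmod a \<le> \<beta> * r}" by (auto simp: D_def divisor_upto_def)
    then show ?thesis
      unfolding close_sum_def q_def D_def
      by (simp add: sum.inter_filter finite_divisor_upto) (intro sum.cong, auto)
  qed
  also have "(\<Sum>a\<in>D. real (ord_at a)) = real (zero_pole_count R f)"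
    by (simp add: zero_pole_count_eq D_def)
  finally have "\<bar>ln (cmod (f w / f z))\<bar> \<le> cmod \<eta> * (4 * \<gamma> / (\<gamma> - 1)\<^sup>2 * mean_abs_log R / r) +
     cmod \<eta> * ((2 / (\<gamma> - 1) + 3 / (\<beta> - 1)) / r * real (zero_pole_count R f) + close_sum \<eta> \<beta> r)"
    using log_ratio_bound[of R z w] reg z R wR fz fw first unfolding D_def R_def by linarith
  then show ?thesis by (simp add: w_def R_def algebra_simps)
qed

end

section \<open>Exceptional sets\<close>

text \<open>\<open>1 / |x - d|\<close> is not integrable at \<open>d\<close>; smoothed at scale
  \<open>\<delta>\<close>, its integral is only logarithmic in \<open>(b - a) / \<delta>\<close>,
  uniformly in \<open>d\<close>. Each side of \<open>d\<close> costs one logarithm.\<close>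

lemma integral_smoothed_reciprocal:
  fixes a b d \<delta> :: real
  assumes "\<delta> > 0" "a \<le> b"
  obtains I where "((\<lambda>x. 1 / (\<delta> + \<bar>x - d\<bar>)) has_integral I) {a..b}" "I \<le> 2 * ln (1 + (b - a) / \<delta>)"
proof -
  have right: "\<exists>I. ((\<lambda>x. 1 / (\<delta> + \<bar>x - d\<bar>)) has_integral I) {u..v} \<and> I \<le> ln (1 + (b - a) / \<delta>)"
    if "d \<le> u" "u \<le> v" "v - u \<le> b - a" for u v
  proof (intro exI conjI)
    have "((\<lambda>x. 1 / (\<delta> + (x - d))) has_integral (ln (\<delta> + (v - d)) - ln (\<delta> + (u - d)))) {u..v}"
      using that assms by (intro fundamental_theorem_of_calculus)
        (auto intro!: derivative_eq_intros simp: has_real_derivative_iff_has_vector_derivative[symmetric])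
    then show "((\<lambda>x. 1 / (\<delta> + \<bar>x - d\<bar>)) has_integral (ln (\<delta> + (v - d)) - ln (\<delta> + (u - d)))) {u..v}"
      by (rule has_integral_eq[rotated]) (use that in auto)
    have "ln (\<delta> + (v - d)) - ln (\<delta> + (u - d)) = ln ((\<delta> + (v - d)) / (\<delta> + (u - d)))"
      using that assms by (subst ln_div) auto
    also have "(\<delta> + (v - d)) / (\<delta> + (u - d)) = 1 + (v - u) / (\<delta> + (u - d))"
      using that assms by (simp add: field_simps)
    also have "ln \<dots> \<le> ln (1 + (b - a) / \<delta>)"
      using that assms by (intro ln_mono add_left_mono frac_le add_pos_nonneg) auto
    finally show "ln (\<delta> + (v - d)) - ln (\<delta> + (u - d)) \<le> ln (1 + (b - a) / \<delta>)" .
  qed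
  have left: "\<exists>I. ((\<lambda>x. 1 / (\<delta> + \<bar>x - d\<bar>)) has_integral I) {u..v} \<and> I \<le> ln (1 + (b - a) / \<delta>)"
    if "v \<le> d" "u \<le> v" "v - u \<le> b - a" for u v
  proof (intro exI conjI)
    have "((\<lambda>x. 1 / (\<delta> + (d - x))) has_integral (- ln (\<delta> + (d - v)) - (- ln (\<delta> + (d - u))))) {u..v}"
      using that assms by (intro fundamental_theorem_of_calculus)
        (auto intro!: derivative_eq_intros simp: has_real_derivative_iff_has_vector_derivative[symmetric])
    then show "((\<lambda>x. 1 / (\<delta> + \<bar>x - d\<bar>)) has_integral (- ln (\<delta> + (d - v)) - (- ln (\<delta> + (d - u))))) {u..v}"
      by (rule has_integral_eq[rotated]) (use that in auto)
    have "- ln (\<delta> + (d - v)) - (- ln (\<delta> + (d - u))) = ln ((\<delta> + (d - u)) / (\<delta> + (d - v)))"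
      using that assms by (subst ln_div) auto
    also have "(\<delta> + (d - u)) / (\<delta> + (d - v)) = 1 + (v - u) / (\<delta> + (d - v))"
      using that assms by (simp add: field_simps)
    also have "ln \<dots> \<le> ln (1 + (b - a) / \<delta>)"
      using that assms by (intro ln_mono add_left_mono frac_le add_pos_nonneg) auto
    finally show "- ln (\<delta> + (d - v)) - (- ln (\<delta> + (d - u))) \<le> ln (1 + (b - a) / \<delta>)" .
  qed
  have nn: "ln (1 + (b - a) / \<delta>) \<ge> 0" using assms by (intro ln_ge_zero) auto
  consider "d \<le> a" | "b \<le> d" | "a \<le> d" "d \<le> b" by linarith
  then show thesis
  proof cases
    case 1
    then obtain I where "((\<lambda>x. 1 / (\<delta> + \<bar>x - d\<bar>)) has_integral I) {a..b}" "I \<le> ln (1 + (b - a) / \<delta>)"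
      using right[of a b] assms by auto
    with nn show thesis by (intro that[of I]) auto
  next
    case 2
    then obtain I where "((\<lambda>x. 1 / (\<delta> + \<bar>x - d\<bar>)) has_integral I) {a..b}" "I \<le> ln (1 + (b - a) / \<delta>)"
      using left[of b a] assms by auto
    with nn show thesis by (intro that[of I]) auto
  next
    case 3
    obtain I where I: "((\<lambda>x. 1 / (\<delta> + \<bar>x - d\<bar>)) has_integral I) {a..d}" "I \<le> ln (1 + (b - a) / \<delta>)"
      using left[of d a] 3 by auto
    obtain J where J: "((\<lambda>x. 1 / (\<delta> + \<bar>x - d\<bar>)) has_integral J) {d..b}" "J \<le> ln (1 + (b - a) / \<delta>)"
      using right[of d b] 3 by auto
    have "((\<lambda>x. 1 / (\<delta> + \<bar>x - d\<bar>)) has_integral (I + J)) {a..b}"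
      by (rule has_integral_combine[OF 3 I(1) J(1)])
    with I(2) J(2) show thesis by (intro that[of "I + J"]) auto
  qed
qed

text \<open>Half of the measure \<open>h\<close> is spent on \<open>\<delta>\<close>-neighbourhoods
  of the points \<open>d s\<close>. Outside them the sum is dominated by its smoothed version
  \<open>F\<close>, and the other half goes to the set where \<open>F\<close> is large, by Markov's
  inequality. The condition \<open>w s >= 1\<close> makes \<open>N\<close> bound the number of
  points too.\<close>

lemma reciprocal_distance_exceptional_set:
  fixes d :: "'a \<Rightarrow> real" and w :: "'a \<Rightarrow> nat" and a b h :: real
  assumes S: "finite S" and w: "\<And>s. s \<in> S \<Longrightarrow> w s \<ge> 1" and ab: "a < b" and h: "h > 0"
  defines "N \<equiv> (\<Sum>s\<in>S. real (w s))"
  obtains E where "E \<subseteq> {a..b}" "E \<in> sets borel" "emeasure lborel E \<le> ennreal h"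
    "\<And>x. x \<in> {a..b} \<Longrightarrow> x \<notin> E \<Longrightarrow>
       (\<Sum>s\<in>S. real (w s) / \<bar>x - d s\<bar>) \<le> 8 * N / h * ln (1 + 4 * N * (b - a) / h)"
proof (cases "S = {}")
  case True
  then show thesis by (intro that[of "{}"]) (auto simp: N_def)
next
  case False
  have cardN: "real (card S) \<le> N"
  proof -
    have "(\<Sum>s\<in>S. 1) \<le> N" unfolding N_def using w by (intro sum_mono) simp
    then show ?thesis by simp
  qed
  moreover have "card S \<ge> 1" using False S by (simp add: Suc_le_eq card_gt_0_iff)
  ultimately have N: "N \<ge> 1" by linarith
  \<comment> \<open>At most \<open>N\<close> intervals of length \<open>2 \<delta>\<close> then have
    total length at most \<open>h / 2\<close>.\<close>
  define \<delta> where "\<delta> = h / (4 * N)"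
  have \<delta>: "\<delta> > 0" using h N by (simp add: \<delta>_def)
  define \<Lambda> where "\<Lambda> = ln (1 + (b - a) / \<delta>)"
  have \<Lambda>: "\<Lambda> > 0" unfolding \<Lambda>_def using \<delta> ab by (intro ln_gt_zero) auto
  \<comment> \<open>\<open>F\<close> has integral at most \<open>4 N \<Lambda>\<close>, so Markov's
    inequality at this level gives measure at most \<open>h / 2\<close>.\<close>
  define lev where "lev = 8 * N / h * \<Lambda>"
  have lev: "lev > 0" using h N \<Lambda> by (simp add: lev_def)
  define F where "F = (\<lambda>x. \<Sum>s\<in>S. 2 * real (w s) * (1 / (\<delta> + \<bar>x - d s\<bar>)))"
  have F0: "F x \<ge> 0" for x unfolding F_def using \<delta> by (intro sum_nonneg) auto
  have "\<exists>I. \<forall>s. ((\<lambda>x. 1 / (\<delta> + \<bar>x - d s\<bar>)) has_integral I s) {a..b} \<and> I s \<le> 2 * \<Lambda>"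
  proof (rule choice, rule allI)
    fix s
    obtain I where "((\<lambda>x. 1 / (\<delta> + \<bar>x - d s\<bar>)) has_integral I) {a..b}" "I \<le> 2 * ln (1 + (b - a) / \<delta>)"
      using integral_smoothed_reciprocal[OF \<delta>, of a b "d s"] ab by auto
    then show "\<exists>I. ((\<lambda>x. 1 / (\<delta> + \<bar>x - d s\<bar>)) has_integral I) {a..b} \<and> I \<le> 2 * \<Lambda>"
      by (auto simp: \<Lambda>_def)
  qed
  then obtain I where I: "\<And>s. ((\<lambda>x. 1 / (\<delta> + \<bar>x - d s\<bar>)) has_integral I s) {a..b}" "\<And>s. I s \<le> 2 * \<Lambda>"
    by blast
  define J where "J = (\<Sum>s\<in>S. 2 * real (w s) * I s)"
  have FJ: "(F has_integral J) {a..b}"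
    unfolding F_def J_def by (intro has_integral_sum has_integral_mult_right I S)
  have "J \<le> (\<Sum>s\<in>S. 2 * real (w s) * (2 * \<Lambda>))"
    unfolding J_def by (intro sum_mono mult_left_mono I) auto
  also have "\<dots> = 4 * N * \<Lambda>" by (simp add: N_def sum_distrib_left sum_distrib_right mult_ac)
  finally have J: "J \<le> 4 * N * \<Lambda>" .
  have contF: "continuous_on UNIV F"
    unfolding F_def using \<delta> by (intro continuous_intros) (metis abs_ge_zero add_pos_nonneg less_irrefl)
  then have measF: "F \<in> borel_measurable borel" by (rule borel_measurable_continuous_onI)
  define E1 where "E1 = (\<Union>s\<in>S. {a..b} \<inter> ball (d s) \<delta>)"
  define E2 where "E2 = {x \<in> {a..b}. 1 \<le> ennreal (1 / lev) * ennreal (F x)}"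
  have E2eq: "E2 = {x \<in> {a..b}. lev \<le> F x}"
  proof -
    have "(1 \<le> ennreal (1 / lev) * ennreal (F x)) \<longleftrightarrow> lev \<le> F x" for x
    proof -
      have "ennreal (1 / lev) * ennreal (F x) = ennreal (F x / lev)"
        using F0[of x] lev by (simp flip: ennreal_mult)
      moreover have "1 \<le> ennreal (F x / lev) \<longleftrightarrow> 1 \<le> F x / lev"
        unfolding ennreal_1[symmetric] using F0[of x] lev by (intro ennreal_le_iff) simp
      ultimately show ?thesis using lev by (simp add: field_simps)
    qed
    then show ?thesis by (simp add: E2_def)
  qed
  have mE1: "E1 \<in> sets borel" unfolding E1_def using S by (intro sets.finite_UN) auto
  have mE2: "E2 \<in> sets borel" unfolding E2eq using measF by measurable
  have "emeasure lborel E1 \<le> (\<Sum>s\<in>S. emeasure lborel ({a..b} \<inter> ball (d s) \<delta>))"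
    unfolding E1_def using S by (intro emeasure_subadditive_finite) auto
  also have "\<dots> \<le> (\<Sum>s\<in>S. ennreal (2 * \<delta>))"
  proof (rule sum_mono)
    fix s
    have "emeasure lborel ({a..b} \<inter> ball (d s) \<delta>) \<le> emeasure lborel {d s - \<delta> .. d s + \<delta>}"
      by (intro emeasure_mono) (auto simp: dist_real_def)
    then show "emeasure lborel ({a..b} \<inter> ball (d s) \<delta>) \<le> ennreal (2 * \<delta>)" using \<delta> by simp
  qed
  also have "\<dots> = ennreal (real (card S) * (2 * \<delta>))"
    using \<delta> by (simp add: ennreal_mult ennreal_of_nat_eq_real_of_nat)
  also have "\<dots> \<le> ennreal (h / 2)"
  proof (rule ennreal_leI)
    have "real (card S) * (2 * \<delta>) \<le> N * (2 * \<delta>)" using cardN \<delta> by (intro mult_right_mono) auto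
    also have "\<dots> = h / 2" using N by (simp add: \<delta>_def)
    finally show "real (card S) * (2 * \<delta>) \<le> h / 2" .
  qed
  finally have e1: "emeasure lborel E1 \<le> ennreal (h / 2)" .
  have "emeasure lborel E2 \<le> ennreal (1 / lev) * (\<integral>\<^sup>+x. ennreal (F x) * indicator {a..b} x \<partial>lborel)"
    unfolding E2_def using measF by (intro nn_integral_Markov_inequality) auto
  also have "(\<integral>\<^sup>+x. ennreal (F x) * indicator {a..b} x \<partial>lborel) = ennreal J"
    by (rule nn_integral_has_integral_lebesgue'[OF _ FJ]) (rule F0)
  also have "ennreal (1 / lev) * ennreal J = ennreal (J / lev)"
    using lev has_integral_nonneg[OF FJ] F0 by (simp flip: ennreal_mult)
  also have "\<dots> \<le> ennreal (h / 2)"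
  proof (rule ennreal_leI)
    have "J / lev \<le> 4 * N * \<Lambda> / lev" using J lev by (intro divide_right_mono) auto
    also have "\<dots> = h / 2" using N \<Lambda> h by (simp add: lev_def)
    finally show "J / lev \<le> h / 2" .
  qed
  finally have e2: "emeasure lborel E2 \<le> ennreal (h / 2)" .
  show thesis
  proof (rule that[of "E1 \<union> E2"])
    show "E1 \<union> E2 \<subseteq> {a..b}" by (auto simp: E1_def E2_def)
    show "E1 \<union> E2 \<in> sets borel" using mE1 mE2 by auto
    have "emeasure lborel (E1 \<union> E2) \<le> emeasure lborel E1 + emeasure lborel E2"
      using mE1 mE2 by (intro emeasure_subadditive) auto
    also have "\<dots> \<le> ennreal (h / 2) + ennreal (h / 2)" by (intro add_mono e1 e2)
    also have "\<dots> = ennreal h" using h by (simp flip: ennreal_plus)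
    finally show "emeasure lborel (E1 \<union> E2) \<le> ennreal h" .
    fix x assume x: "x \<in> {a..b}" "x \<notin> E1 \<union> E2"
    have "(\<Sum>s\<in>S. real (w s) / \<bar>x - d s\<bar>) \<le> F x"
      unfolding F_def
    proof (rule sum_mono)
      fix s assume "s \<in> S"
      then have "\<delta> \<le> \<bar>x - d s\<bar>" using x by (auto simp: E1_def dist_real_def)
      \<comment> \<open>Outside \<open>E1\<close> the smoothing at most doubles the denominator;
        this is the factor 2 in \<open>F\<close>.\<close>
      then have "1 / \<bar>x - d s\<bar> \<le> 2 / (\<delta> + \<bar>x - d s\<bar>)" using \<delta> by (simp add: field_simps)
      from mult_left_mono[OF this, of "real (w s)"]
      show "real (w s) / \<bar>x - d s\<bar> \<le> 2 * real (w s) * (1 / (\<delta> + \<bar>x - d s\<bar>))"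
        by (simp add: mult_ac)
    qed
    also have "F x \<le> lev" using x unfolding E2eq by auto
    also have "lev = 8 * N / h * ln (1 + 4 * N * (b - a) / h)"
      using h N by (simp add: lev_def \<Lambda>_def \<delta>_def mult_ac)
    finally show "(\<Sum>s\<in>S. real (w s) / \<bar>x - d s\<bar>) \<le> 8 * N / h * ln (1 + 4 * N * (b - a) / h)" .
  qed
qed

section \<open>Sets of finite logarithmic measure\<close>

lemma borel_measurable_recip_lebesgue: "(\<lambda>t::real. ennreal (1 / t)) \<in> borel_measurable lebesgue"
  by (intro measurable_completion) measurable

text \<open>As the measure with density \<open>1 / t\<close>, logarithmic measure inherits
  monotonicity and subadditivity.\<close>

lemma finite_log_measure_altdef:
  "finite_log_measure E \<longleftrightarrow> E \<in> sets lebesgue \<and> emeasure (density lebesgue (\<lambda>t. ennreal (1 / t))) E < \<infinity>"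
  by (auto simp: finite_log_measure_def emeasure_density[OF borel_measurable_recip_lebesgue])

lemma finite_log_measure_subset:
  assumes "finite_log_measure A" "B \<subseteq> A" "B \<in> sets lebesgue"
  shows "finite_log_measure B"
proof -
  let ?M = "density lebesgue (\<lambda>t. ennreal (1 / t))"
  have "emeasure ?M B \<le> emeasure ?M A"
    using assms by (intro emeasure_mono) (auto simp: finite_log_measure_altdef)
  then show ?thesis
    using assms by (auto simp: finite_log_measure_altdef intro: le_less_trans)
qed

lemma finite_log_measure_Un:
  assumes "finite_log_measure A" "finite_log_measure B"
  shows "finite_log_measure (A \<union> B)"
proof -
  let ?M = "density lebesgue (\<lambda>t. ennreal (1 / t))"
  have "emeasure ?M (A \<union> B) \<le> emeasure ?M A + emeasure ?M B"
    using assms by (intro emeasure_subadditive) (auto simp: finite_log_measure_altdef)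
  then show ?thesis
    using assms by (auto simp: finite_log_measure_altdef intro: le_less_trans)
qed

text \<open>On \<open>{c m..}\<close> the density is at most \<open>1 / c m\<close>, so the m-th set
  has logarithmic measure at most \<open>h m / c m\<close>.\<close>

lemma finite_log_measure_UN:
  fixes E :: "nat \<Rightarrow> real set"
  assumes E: "\<And>m. E m \<in> sets borel" "\<And>m. E m \<subseteq> {c m..}" and c: "\<And>m. c m > 0"
    and h: "\<And>m. emeasure lborel (E m) \<le> ennreal (h m)" "\<And>m. h m \<ge> 0" "summable (\<lambda>m. h m / c m)"
  shows "finite_log_measure (\<Union>m. E m)"
proof -
  let ?M = "density lebesgue (\<lambda>t. ennreal (1 / t))"
  have meas: "E m \<in> sets lebesgue" for m using E(1) by auto
  have "emeasure ?M (E m) \<le> ennreal (h m / c m)" for m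
  proof -
    have "emeasure ?M (E m) = (\<integral>\<^sup>+t. ennreal (1 / t) * indicator (E m) t \<partial>lebesgue)"
      by (rule emeasure_density[OF borel_measurable_recip_lebesgue meas])
    also have "\<dots> \<le> (\<integral>\<^sup>+t. ennreal (1 / c m) * indicator (E m) t \<partial>lebesgue)"
      using E(2)[of m] c[of m]
      by (intro nn_integral_mono) (auto simp: indicator_def intro!: ennreal_leI divide_left_mono)
    also have "\<dots> = ennreal (1 / c m) * emeasure lborel (E m)"
      using meas E(1) by (simp add: nn_integral_cmult_indicator)
    also have "\<dots> \<le> ennreal (1 / c m) * ennreal (h m)" by (intro mult_left_mono h) auto
    also have "\<dots> = ennreal (h m / c m)" using h(2)[of m] c[of m] by (simp flip: ennreal_mult)
    finally show ?thesis .
  qed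
  then have "(\<Sum>m. emeasure ?M (E m)) \<le> (\<Sum>m. ennreal (h m / c m))"
    by (intro suminf_le) auto
  moreover have "emeasure ?M (\<Union>m. E m) \<le> (\<Sum>m. emeasure ?M (E m))"
    using meas by (intro emeasure_subadditive_countably) auto
  moreover have "(\<Sum>m. ennreal (h m / c m)) < \<infinity>"
    using h c by (subst suminf_ennreal2) (auto simp: less_imp_le)
  ultimately show ?thesis using meas by (auto simp: finite_log_measure_altdef)
qed

lemma finite_log_measure_bounded:
  assumes "E \<in> sets borel" "E \<subseteq> {1..R}"
  shows "finite_log_measure E"
proof -
  have "finite_log_measure (\<Union>m::nat. if m = 0 then E else {})"
  proof (rule finite_log_measure_UN[of _ "\<lambda>_. 1" "\<lambda>m. if m = 0 then max 0 (R - 1) else 0"])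
    have "emeasure lborel E \<le> emeasure lborel {1..R}" using assms by (intro emeasure_mono) auto
    also have "\<dots> \<le> ennreal (max 0 (R - 1))" by (cases "1 \<le> R") auto
    finally show "emeasure lborel (if m = 0 then E else {}) \<le> ennreal (if m = 0 then max 0 (R - 1) else 0)" for m :: nat
      by simp
    show "summable (\<lambda>m::nat. (if m = 0 then max 0 (R - 1) else 0) / (1::real))"
      by (rule summable_finite[of "{0}"]) auto
  qed (use assms in auto)
  moreover have "(\<Union>m::nat. if m = 0 then E else {}) = E" by (auto split: if_splits)
  ultimately show ?thesis by simp
qed

lemma finite_log_measure_countable:
  assumes "countable E" "E \<subseteq> {1..}"
  shows "finite_log_measure E"
proof -
  have m: "E \<in> sets borel" by (rule sets.countable[OF _ assms(1)]) auto
  have "finite_log_measure (\<Union>m::nat. E)"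
    by (rule finite_log_measure_UN[of _ "\<lambda>_. 1" "\<lambda>_. 0"])
      (use assms m in \<open>auto simp: emeasure_lborel_countable\<close>)
  then show ?thesis by simp
qed

section \<open>Exceptional radii on geometric annuli\<close>

context plane_meromorphic
begin

lemma divisor_upto_mono: "s \<le> t \<Longrightarrow> divisor_upto s \<subseteq> divisor_upto t"
  by (auto simp: divisor_upto_def)

lemma zero_pole_count_mono: "s \<le> t \<Longrightarrow> zero_pole_count s f \<le> zero_pole_count t f"
  unfolding zero_pole_count_eq by (intro sum_mono2 finite_divisor_upto divisor_upto_mono) auto

lemma ord_at_pos: "f a = 0 \<Longrightarrow> ord_at a \<ge> 1"
  using zero_iff_zorder[of a] by (simp add: ord_at_def)

text \<open>The m-th annulus may lose measure \<open>\<beta>^m / (m+1)^\<kappa>\<close>, that is,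
  logarithmic measure \<open>(m+1)^(-\<kappa>)\<close>, summable for \<open>\<kappa> > 1\<close>.
  The sum runs up to \<open>\<beta>^(m+2)\<close> because \<open>\<beta> r\<close> can be that large
  on the annulus. A general \<open>d\<close> serves for both \<open>|a|\<close> and
  \<open>|a - \<eta>|\<close>.\<close>

lemma annuli_exceptional_set:
  fixes d :: "complex \<Rightarrow> real"
  assumes "\<beta> > 1" "\<kappa> > 1"
  obtains E where "finite_log_measure E" "E \<subseteq> {1..}"
    "\<And>m r. \<beta> ^ m \<le> r \<Longrightarrow> r \<le> \<beta> ^ Suc m \<Longrightarrow> r \<notin> E \<Longrightarrow>
       (\<Sum>a\<in>divisor_upto (\<beta> ^ (m + 2)). real (ord_at a) / \<bar>r - d a\<bar>) \<le>
         8 * real (zero_pole_count (\<beta> ^ (m + 2)) f) * real (Suc m) powr \<kappa> / \<beta> ^ m *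
           ln (1 + 4 * real (zero_pole_count (\<beta> ^ (m + 2)) f) * (\<beta> - 1) * real (Suc m) powr \<kappa>)"
proof -
  define h where "h = (\<lambda>m. \<beta> ^ m / real (Suc m) powr \<kappa>)"
  define N where "N = (\<lambda>m. real (zero_pole_count (\<beta> ^ (m + 2)) f))"
  have Neq: "N m = (\<Sum>a\<in>divisor_upto (\<beta> ^ (m + 2)). real (ord_at a))" for m
    by (simp add: N_def zero_pole_count_eq)
  have h0: "h m > 0" for m using assms by (simp add: h_def)
  have "\<exists>E. \<forall>m. E m \<subseteq> {\<beta> ^ m..\<beta> ^ Suc m} \<and> E m \<in> sets borel \<and> emeasure lborel (E m) \<le> ennreal (h m) \<and>
     (\<forall>r. r \<in> {\<beta> ^ m..\<beta> ^ Suc m} \<longrightarrow> r \<notin> E m \<longrightarrow>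
       (\<Sum>a\<in>divisor_upto (\<beta> ^ (m + 2)). real (ord_at a) / \<bar>r - d a\<bar>) \<le>
         8 * N m / h m * ln (1 + 4 * N m * (\<beta> ^ Suc m - \<beta> ^ m) / h m))"
  proof (rule choice, rule allI)
    fix m
    have lt: "\<beta> ^ m < \<beta> ^ Suc m" using assms by simp
    have o: "ord_at a \<ge> 1" if "a \<in> divisor_upto (\<beta> ^ (m + 2))" for a
      using that ord_at_pos by (auto simp: divisor_upto_def)
    show "\<exists>E. E \<subseteq> {\<beta> ^ m..\<beta> ^ Suc m} \<and> E \<in> sets borel \<and> emeasure lborel E \<le> ennreal (h m) \<and>
     (\<forall>r. r \<in> {\<beta> ^ m..\<beta> ^ Suc m} \<longrightarrow> r \<notin> E \<longrightarrow>
       (\<Sum>a\<in>divisor_upto (\<beta> ^ (m + 2)). real (ord_at a) / \<bar>r - d a\<bar>) \<le>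
         8 * N m / h m * ln (1 + 4 * N m * (\<beta> ^ Suc m - \<beta> ^ m) / h m))"
      unfolding Neq
      by (rule reciprocal_distance_exceptional_set[OF finite_divisor_upto o lt h0[of m], where d = d]) blast+
  qed
  then obtain E where E: "\<And>m. E m \<subseteq> {\<beta> ^ m..\<beta> ^ Suc m}" "\<And>m. E m \<in> sets borel"
    "\<And>m. emeasure lborel (E m) \<le> ennreal (h m)"
    "\<And>m r. r \<in> {\<beta> ^ m..\<beta> ^ Suc m} \<Longrightarrow> r \<notin> E m \<Longrightarrow>
       (\<Sum>a\<in>divisor_upto (\<beta> ^ (m + 2)). real (ord_at a) / \<bar>r - d a\<bar>) \<le>
         8 * N m / h m * ln (1 + 4 * N m * (\<beta> ^ Suc m - \<beta> ^ m) / h m)"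
    by blast
  show thesis
  proof (rule that[of "\<Union>m. E m"])
    have "summable (\<lambda>m. real (Suc m) powr (- \<kappa>))"
      using assms by (subst summable_Suc_iff) (simp add: summable_real_powr_iff)
    then have "summable (\<lambda>m. h m / \<beta> ^ m)"
      using assms by (simp add: h_def powr_minus field_simps)
    moreover have "E m \<subseteq> {\<beta> ^ m..}" for m using E(1)[of m] by auto
    ultimately show "finite_log_measure (\<Union>m. E m)"
      using E(2,3) h0 assms
      by (intro finite_log_measure_UN[where c = "\<lambda>m. \<beta> ^ m" and h = h]) (auto simp: less_imp_le)
    show "(\<Union>m. E m) \<subseteq> {1..}"
    proof
      fix x assume "x \<in> (\<Union>m. E m)"
      then obtain m where "x \<in> E m" by blast
      then have "\<beta> ^ m \<le> x" using E(1) by fastforce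
      moreover have "1 \<le> \<beta> ^ m" using assms by simp
      ultimately show "x \<in> {1..}" by simp
    qed
    fix m r assume r: "\<beta> ^ m \<le> r" "r \<le> \<beta> ^ Suc m" "r \<notin> (\<Union>m. E m)"
    have "(\<Sum>a\<in>divisor_upto (\<beta> ^ (m + 2)). real (ord_at a) / \<bar>r - d a\<bar>) \<le>
         8 * N m / h m * ln (1 + 4 * N m * (\<beta> ^ Suc m - \<beta> ^ m) / h m)"
      using E(4)[of r m] r by auto
    also have "8 * N m / h m = 8 * N m * real (Suc m) powr \<kappa> / \<beta> ^ m"
      by (simp add: h_def)
    also have "4 * N m * (\<beta> ^ Suc m - \<beta> ^ m) / h m = 4 * N m * (\<beta> - 1) * real (Suc m) powr \<kappa>"
    proof -
      have "\<beta> ^ Suc m - \<beta> ^ m = \<beta> ^ m * (\<beta> - 1)" by (simp add: algebra_simps)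
      then show ?thesis using assms by (simp add: h_def)
    qed
    finally show "(\<Sum>a\<in>divisor_upto (\<beta> ^ (m + 2)). real (ord_at a) / \<bar>r - d a\<bar>) \<le>
         8 * real (zero_pole_count (\<beta> ^ (m + 2)) f) * real (Suc m) powr \<kappa> / \<beta> ^ m *
           ln (1 + 4 * real (zero_pole_count (\<beta> ^ (m + 2)) f) * (\<beta> - 1) * real (Suc m) powr \<kappa>)"
      by (simp only: N_def)
  qed
qed

text \<open>On the m-th annulus \<open>m\<close> is comparable to \<open>ln r\<close>, so the
  annular bound becomes a power of \<open>ln r\<close> times a logarithm of the count. The
  assumption \<open>two\<close> makes \<open>ln n >= ln 2\<close>, without which the logarithm of
  \<open>m\<close> could not be put into a multiple of \<open>ln n\<close>.\<close>

lemma near_sum_exceptional_set: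
  fixes d :: "complex \<Rightarrow> real"
  assumes \<beta>: "\<beta> > 1" and \<gamma>: "\<gamma> = \<beta>\<^sup>2" and two: "zero_pole_count t f \<ge> 2"
  obtains E r0 where "finite_log_measure E" "E \<subseteq> {1..}"
    "\<And>r. r \<ge> r0 \<Longrightarrow> r \<notin> E \<Longrightarrow>
       (\<Sum>a\<in>divisor_upto (\<beta> * r). real (ord_at a) / \<bar>r - d a\<bar>) \<le>
         real (zero_pole_count (\<gamma> * r) f) / r * (ln r) powr \<gamma> * ln (real (zero_pole_count (\<gamma> * r) f))"
proof -
  have \<gamma>1: "\<gamma> > 1" using \<beta> by (simp add: \<gamma> one_less_power)
  \<comment> \<open>Above 1 for summability, below \<open>\<gamma>\<close> for the absorption that
    follows.\<close>
  define \<kappa> where "\<kappa> = (1 + \<gamma>) / 2"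
  have \<kappa>: "1 < \<kappa>" "\<kappa> < \<gamma>" using \<gamma>1 by (auto simp: \<kappa>_def)
  obtain E where E: "finite_log_measure E" "E \<subseteq> {1..}"
    "\<And>m r. \<beta> ^ m \<le> r \<Longrightarrow> r \<le> \<beta> ^ Suc m \<Longrightarrow> r \<notin> E \<Longrightarrow>
       (\<Sum>a\<in>divisor_upto (\<beta> ^ (m + 2)). real (ord_at a) / \<bar>r - d a\<bar>) \<le>
         8 * real (zero_pole_count (\<beta> ^ (m + 2)) f) * real (Suc m) powr \<kappa> / \<beta> ^ m *
           ln (1 + 4 * real (zero_pole_count (\<beta> ^ (m + 2)) f) * (\<beta> - 1) * real (Suc m) powr \<kappa>)"
    by (rule annuli_exceptional_set[OF \<beta> \<kappa>(1), of d]) blast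
  define c where "c = (\<lambda>m. (\<beta> - 1) * real (Suc m) powr \<kappa>)"
  \<comment> \<open>Since \<open>\<kappa> < \<gamma>\<close>, the constants and the factor of order
    \<open>ln m\<close> are absorbed. Thus the conclusion has constant 1, and only the threshold
    \<open>r0\<close> depends on \<open>f\<close>.\<close>
  have "eventually (\<lambda>m. 8 * \<beta> * real (Suc m) powr \<kappa> * (1 + ln (1 + 4 * ((\<beta> - 1) * real (Suc m) powr \<kappa>)) / ln 2)
            \<le> (real m * ln \<beta>) powr \<gamma>) sequentially"
    using \<kappa> \<beta> \<gamma>1 ln_gt_zero[OF \<beta>] by real_asymp
  then obtain m0 where m0: "\<And>m. m \<ge> m0 \<Longrightarrow>
      8 * \<beta> * real (Suc m) powr \<kappa> * (1 + ln (1 + 4 * c m) / ln 2) \<le> (real m * ln \<beta>) powr \<gamma>"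
    by (auto simp: eventually_sequentially c_def)
  show thesis
  proof (rule that[OF E(1,2), of "max (\<beta> ^ m0) t"])
    fix r assume r: "r \<ge> max (\<beta> ^ m0) t" "r \<notin> E"
    have bm0: "\<beta> ^ m0 \<ge> 1" using \<beta> by simp
    have r1: "r \<ge> 1" using r bm0 by linarith
    define m where "m = nat \<lfloor>log \<beta> r\<rfloor>"
    have l0: "log \<beta> r \<ge> 0" using r1 \<beta> by simp
    then have ml: "real m \<le> log \<beta> r" "log \<beta> r \<le> real (Suc m)" unfolding m_def by linarith+
    have mlow: "\<beta> ^ m \<le> r"
      using powr_mono[OF ml(1), of \<beta>] \<beta> r1 by (simp add: powr_realpow)
    have mup: "r \<le> \<beta> ^ Suc m"
      using powr_mono[OF ml(2), of \<beta>] \<beta> r1 by (simp add: powr_realpow del: of_nat_Suc power_Suc)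
    have mm0: "m0 \<le> m"
    proof -
      have "real m0 = log \<beta> (\<beta> ^ m0)" using \<beta> by simp
      also have "\<dots> \<le> log \<beta> r"
      proof (rule log_mono)
        show "0 < \<beta> ^ m0" using bm0 by linarith
      qed (use r \<beta> in auto)
      finally show ?thesis unfolding m_def by linarith
    qed
    define n where "n = real (zero_pole_count (\<gamma> * r) f)"
    define N where "N = real (zero_pole_count (\<beta> ^ (m + 2)) f)"
    \<comment> \<open>Here \<open>\<gamma> = \<beta>^2\<close> is used: the annular count is at most
      the count at \<open>\<gamma> r\<close>.\<close>
    have "\<beta> ^ (m + 2) = \<gamma> * \<beta> ^ m" by (simp add: \<gamma> power_add power2_eq_square)
    also have "\<dots> \<le> \<gamma> * r" using mlow \<gamma>1 by (intro mult_left_mono) auto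
    finally have Nn: "N \<le> n" unfolding N_def n_def by (simp add: zero_pole_count_mono)
    have "1 * r \<le> \<gamma> * r" using r1 \<gamma>1 by (intro mult_right_mono) auto
    then have "t \<le> \<gamma> * r" using r by simp
    then have n2: "n \<ge> 2" using two zero_pole_count_mono[of t "\<gamma> * r"] by (simp add: n_def)
    have N0: "N \<ge> 0" by (simp add: N_def)
    have c0: "c m \<ge> 0" using \<beta> by (simp add: c_def)
    have "ln (1 + 4 * N * c m) \<le> ln (n * (1 + 4 * c m))"
    proof (rule ln_mono)
      have "N * c m \<le> n * c m" using Nn c0 by (intro mult_right_mono)
      then show "1 + 4 * N * c m \<le> n * (1 + 4 * c m)" using n2 by (simp add: algebra_simps)
      show "0 < 1 + 4 * N * c m" using N0 c0 by (intro add_pos_nonneg) auto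
    qed
    also have "\<dots> = ln n + ln (1 + 4 * c m)" using n2 c0 by (subst ln_mult_pos) auto
    \<comment> \<open>The factor \<open>ln n / ln 2\<close> is at least 1, which turns a sum of
      logarithms into a multiple of \<open>ln n\<close>.\<close>
    also have "\<dots> \<le> ln n + ln (1 + 4 * c m) * (ln n / ln 2)"
    proof -
      have "ln (1 + 4 * c m) \<ge> 0" using c0 by simp
      moreover have "ln n / ln 2 \<ge> 1" using n2 by (simp add: field_simps)
      ultimately show ?thesis using mult_left_mono[of 1 "ln n / ln 2" "ln (1 + 4 * c m)"] by simp
    qed
    also have "\<dots> = ln n * (1 + ln (1 + 4 * c m) / ln 2)" by (simp add: algebra_simps)
    finally have lnb: "ln (1 + 4 * N * c m) \<le> ln n * (1 + ln (1 + 4 * c m) / ln 2)" .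
    have "\<beta> * r \<le> \<beta> ^ (m + 2)" using mup \<beta> by simp
    then have "(\<Sum>a\<in>divisor_upto (\<beta> * r). real (ord_at a) / \<bar>r - d a\<bar>) \<le>
        (\<Sum>a\<in>divisor_upto (\<beta> ^ (m + 2)). real (ord_at a) / \<bar>r - d a\<bar>)"
      by (intro sum_mono2 finite_divisor_upto divisor_upto_mono) auto
    also have "\<dots> \<le> 8 * N * real (Suc m) powr \<kappa> / \<beta> ^ m * ln (1 + 4 * N * c m)"
      using E(3)[OF mlow mup r(2)] unfolding N_def c_def by (simp only: mult.assoc)
    also have "\<dots> \<le> 8 * n * real (Suc m) powr \<kappa> * (\<beta> / r) * (ln n * (1 + ln (1 + 4 * c m) / ln 2))"
    proof (rule mult_mono[OF _ lnb])
      have "1 / \<beta> ^ m \<le> \<beta> / r" using mup \<beta> r1 by (simp add: field_simps)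
      then have "8 * N * real (Suc m) powr \<kappa> * (1 / \<beta> ^ m) \<le> 8 * n * real (Suc m) powr \<kappa> * (\<beta> / r)"
        using Nn N0 n2 \<beta> by (intro mult_mono) auto
      then show "8 * N * real (Suc m) powr \<kappa> / \<beta> ^ m \<le> 8 * n * real (Suc m) powr \<kappa> * (\<beta> / r)" by simp
    qed (use n2 \<beta> r1 N0 c0 in auto)
    also have "\<dots> = n / r * ln n * (8 * \<beta> * real (Suc m) powr \<kappa> * (1 + ln (1 + 4 * c m) / ln 2))"
      by (simp add: mult_ac)
    also have "\<dots> \<le> n / r * ln n * (ln r) powr \<gamma>"
    proof (rule mult_left_mono)
      have "8 * \<beta> * real (Suc m) powr \<kappa> * (1 + ln (1 + 4 * c m) / ln 2) \<le> (real m * ln \<beta>) powr \<gamma>"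
        by (rule m0[OF mm0])
      also have "\<dots> \<le> (ln r) powr \<gamma>"
        using ml(1) \<beta> \<gamma>1 by (intro powr_mono2) (auto simp: log_def field_simps)
      finally show "8 * \<beta> * real (Suc m) powr \<kappa> * (1 + ln (1 + 4 * c m) / ln 2) \<le> (ln r) powr \<gamma>" .
      show "0 \<le> n / r * ln n" using n2 r1 by simp
    qed
    finally show "(\<Sum>a\<in>divisor_upto (\<beta> * r). real (ord_at a) / \<bar>r - d a\<bar>) \<le>
         real (zero_pole_count (\<gamma> * r) f) / r * (ln r) powr \<gamma> * ln (real (zero_pole_count (\<gamma> * r) f))"
      by (simp add: n_def mult_ac)
  qed
qed

text \<open>If the count never reaches 2, \<open>log_plus\<close> of it is 0 and the main term
  offers nothing; the summand \<open>4 / r\<close> serves this case, where at most one simple zero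
  or pole exists and is far away for large \<open>r\<close>. Otherwise the previous lemma is applied
  once to \<open>|a|\<close> and once to \<open>|a - \<eta>|\<close>.\<close>

lemma close_sum_exceptional_set:
  assumes \<beta>: "\<beta> > 1" and \<gamma>: "\<gamma> = \<beta>\<^sup>2"
  obtains E r0 where "finite_log_measure E" "E \<subseteq> {1..}"
    "\<And>r. r \<ge> r0 \<Longrightarrow> r \<notin> E \<Longrightarrow>
       close_sum \<eta> \<beta> r \<le> 4 / r + 2 * (real (zero_pole_count (\<gamma> * r) f) / r * (ln r) powr \<gamma> *
          log_plus (real (zero_pole_count (\<gamma> * r) f)))"
proof (cases "\<exists>t. zero_pole_count t f \<ge> 2")
  case True
  then obtain t where t: "zero_pole_count t f \<ge> 2" by blast
  obtain E1 r1 where 1: "finite_log_measure E1" "E1 \<subseteq> {1..}"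
    "\<And>r. r \<ge> r1 \<Longrightarrow> r \<notin> E1 \<Longrightarrow>
       (\<Sum>a\<in>divisor_upto (\<beta> * r). real (ord_at a) / \<bar>r - cmod a\<bar>) \<le>
         real (zero_pole_count (\<gamma> * r) f) / r * (ln r) powr \<gamma> * ln (real (zero_pole_count (\<gamma> * r) f))"
    by (rule near_sum_exceptional_set[OF \<beta> \<gamma> t, of cmod]) blast
  obtain E2 r2 where 2: "finite_log_measure E2" "E2 \<subseteq> {1..}"
    "\<And>r. r \<ge> r2 \<Longrightarrow> r \<notin> E2 \<Longrightarrow>
       (\<Sum>a\<in>divisor_upto (\<beta> * r). real (ord_at a) / \<bar>r - cmod (a - \<eta>)\<bar>) \<le>
         real (zero_pole_count (\<gamma> * r) f) / r * (ln r) powr \<gamma> * ln (real (zero_pole_count (\<gamma> * r) f))"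
    by (rule near_sum_exceptional_set[OF \<beta> \<gamma> t, of "\<lambda>a. cmod (a - \<eta>)"]) blast
  show thesis
  proof (rule that[OF finite_log_measure_Un[OF 1(1) 2(1)], of "max 1 (max r1 r2)"])
    show "E1 \<union> E2 \<subseteq> {1..}" using 1 2 by blast
    fix r assume r: "r \<ge> max 1 (max r1 r2)" "r \<notin> E1 \<union> E2"
    define n where "n = real (zero_pole_count (\<gamma> * r) f)"
    have "close_sum \<eta> \<beta> r \<le> 2 * (n / r * (ln r) powr \<gamma> * ln n)"
    proof -
      have "close_sum \<eta> \<beta> r = (\<Sum>a\<in>divisor_upto (\<beta> * r). real (ord_at a) / \<bar>r - cmod a\<bar>) +
          (\<Sum>a\<in>divisor_upto (\<beta> * r). real (ord_at a) / \<bar>r - cmod (a - \<eta>)\<bar>)"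
        by (simp add: close_sum_def sum.distrib distrib_left)
      also have "\<dots> \<le> n / r * (ln r) powr \<gamma> * ln n + n / r * (ln r) powr \<gamma> * ln n"
        unfolding n_def using r by (intro add_mono 1(3) 2(3)) auto
      finally show ?thesis by (simp add: mult_ac)
    qed
    also have "\<dots> \<le> 2 * (n / r * (ln r) powr \<gamma> * log_plus n)"
      using r by (intro mult_left_mono) (auto simp: log_plus_def n_def)
    also have "\<dots> \<le> 4 / r + 2 * (n / r * (ln r) powr \<gamma> * log_plus n)" using r by simp
    finally show "close_sum \<eta> \<beta> r \<le> 4 / r + 2 * (real (zero_pole_count (\<gamma> * r) f) / r * (ln r) powr \<gamma> *
          log_plus (real (zero_pole_count (\<gamma> * r) f)))" by (simp only: n_def)
  qed
next
  case False
  then have one: "zero_pole_count t f \<le> 1" for t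
    by (metis Suc_1 not_less_eq_eq)
  obtain a0 where sub: "\<And>t. divisor_upto t \<subseteq> {a0}"
  proof (cases "\<exists>a. f a = 0")
    case True
    then obtain a0 where a0: "f a0 = 0" by blast
    have "a = a0" if "f a = 0" for a
    proof (rule ccontr)
      assume ne: "a \<noteq> a0"
      define t where "t = max (cmod a) (cmod a0)"
      have "ord_at a + ord_at a0 = (\<Sum>x\<in>{a, a0}. ord_at x)" using ne by simp
      also have "\<dots> \<le> zero_pole_count t f"
        unfolding zero_pole_count_eq using that a0
        by (intro sum_mono2 finite_divisor_upto) (auto simp: divisor_upto_def t_def)
      finally show False using one[of t] ord_at_pos[OF that] ord_at_pos[OF a0] by simp
    qed
    then show thesis using that[of a0] by (auto simp: divisor_upto_def)
  next
    case False
    then show thesis using that[of 0] by (auto simp: divisor_upto_def)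
  qed
  show thesis
  \<comment> \<open>Beyond this threshold \<open>|a0|\<close> and \<open>|a0 - \<eta>|\<close> are
    at most \<open>r / 2\<close>, so each reciprocal is at most \<open>2 / r\<close>.\<close>
  proof (rule that[of "{}" "max 1 (2 * (cmod a0 + cmod \<eta>))"])
    show "finite_log_measure {}" by (rule finite_log_measure_countable) auto
    fix r assume r: "r \<ge> max 1 (2 * (cmod a0 + cmod \<eta>))"
    have r': "r \<ge> 1" "2 * cmod a0 + 2 * cmod \<eta> \<le> r" using r by (auto simp: distrib_left)
    have "r / 2 \<le> r - cmod a0" using r' norm_ge_zero[of \<eta>] by linarith
    then have d1: "r / 2 \<le> \<bar>r - cmod a0\<bar>" using abs_ge_self order_trans by blast
    have "r / 2 \<le> r - cmod (a0 - \<eta>)" using r' norm_triangle_ineq4[of a0 \<eta>] by linarith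
    then have d2: "r / 2 \<le> \<bar>r - cmod (a0 - \<eta>)\<bar>" using abs_ge_self order_trans by blast
    have inv: "1 / x \<le> 2 / r" if "x \<ge> r / 2" for x using that r by (simp add: field_simps)
    have "close_sum \<eta> \<beta> r \<le> (\<Sum>a\<in>divisor_upto (\<beta> * r). real (ord_at a) * (4 / r))"
      unfolding close_sum_def
    proof (intro sum_mono mult_left_mono)
      fix a assume "a \<in> divisor_upto (\<beta> * r)"
      then have "a = a0" using sub by blast
      then show "1 / \<bar>r - cmod a\<bar> + 1 / \<bar>r - cmod (a - \<eta>)\<bar> \<le> 4 / r"
        using inv[OF d1] inv[OF d2] by simp
    qed simp
    also have "\<dots> = real (zero_pole_count (\<beta> * r) f) * (4 / r)"
      by (simp add: zero_pole_count_eq sum_distrib_right sum_divide_distrib)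
    also have "\<dots> \<le> 1 * (4 / r)" using one[of "\<beta> * r"] r by (intro mult_right_mono) auto
    finally have "close_sum \<eta> \<beta> r \<le> 4 / r" by simp
    moreover have "0 \<le> 2 * (real (zero_pole_count (\<gamma> * r) f) / r * (ln r) powr \<gamma> *
          log_plus (real (zero_pole_count (\<gamma> * r) f)))"
      using r log_plus_nonneg by auto
    ultimately show "close_sum \<eta> \<beta> r \<le> 4 / r + 2 * (real (zero_pole_count (\<gamma> * r) f) / r * (ln r) powr \<gamma> *
          log_plus (real (zero_pole_count (\<gamma> * r) f)))" by linarith
  qed auto
qed

end

section \<open>The estimate for the shift\<close>

context plane_meromorphic
begin

lemma countable_zeros: "countable {a. f a = 0}"
proof -
  have "{a. f a = 0} = (\<Union>n. divisor_upto (real n))"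
    by (auto simp: divisor_upto_def intro: real_arch_simple)
  then show ?thesis by (simp add: countable_finite finite_divisor_upto)
qed

text \<open>In \<open>A\<close>, the part with \<open>12 \<gamma>\<close> is three times the
  coefficient of the Schwarz term, as \<open>2 T + K <= 3 T\<close>; the two others generously cover
  the multiples of \<open>T / r\<close> and of the logarithmic term produced by \<open>n / r\<close>
  and by \<open>close_sum\<close>.\<close>

lemma log_shift_estimate:
  fixes \<eta> :: complex
  assumes \<beta>: "\<beta> > 1" and \<gamma>: "\<gamma> = \<beta>\<^sup>2"
  defines "A \<equiv> cmod \<eta> * (12 * \<gamma> / (\<gamma> - 1)\<^sup>2 + 4 * (2 / (\<gamma> - 1) + 3 / (\<beta> - 1)) + 6)"
  obtains E where "finite_log_measure E" "E \<subseteq> {1..}"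
    "\<And>z r. cmod z = r \<Longrightarrow> r > 1 \<Longrightarrow> r \<notin> E \<Longrightarrow>
       f z \<noteq> 0 \<and> f (z + \<eta>) \<noteq> 0 \<and> regular_radius (\<gamma> * r) \<and> regular_radius (\<gamma>\<^sup>2 * r) \<and>
       \<bar>ln (cmod (f (z + \<eta>) / f z))\<bar> \<le>
         A * (nevanlinna_T (\<gamma> * r) f / r +
           real (zero_pole_count (\<gamma> * r) f) / r * (ln r) powr \<gamma> *
             log_plus (real (zero_pole_count (\<gamma> * r) f)))"
proof -
  have \<gamma>1: "\<gamma> > 1" using \<beta> by (simp add: \<gamma> one_less_power)
  have \<beta>\<gamma>: "\<beta> < \<gamma>" using \<beta> by (simp add: \<gamma> power2_eq_square)
  have A0: "A \<ge> 0" using \<beta> \<gamma>1 by (simp add: A_def)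
  \<comment> \<open>Avoiding \<open>|a|\<close> and \<open>|a - \<eta>|\<close> keeps zeros and
    poles away from \<open>z\<close> and \<open>z + \<eta>\<close>; the two quotients make
    \<open>\<gamma> r\<close> and \<open>\<gamma>^2 r\<close> regular.\<close>
  define Z where "Z = {1<..} \<inter> (\<Union>a\<in>{a. f a = 0}. {cmod a, cmod (a - \<eta>), cmod a / \<gamma>, cmod a / \<gamma>\<^sup>2})"
  have Zc: "countable Z" unfolding Z_def
    by (intro countable_Int2 countable_UN countable_zeros) auto
  have Z: "finite_log_measure Z" by (rule finite_log_measure_countable[OF Zc]) (auto simp: Z_def)
  have regular: "(\<forall>a. f a = 0 \<longrightarrow> cmod a \<noteq> r \<and> cmod (a - \<eta>) \<noteq> r) \<and> regular_radius (\<gamma> * r) \<and> regular_radius (\<gamma>\<^sup>2 * r)"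
    if "r > 1" "r \<notin> Z" for r
    using that \<gamma>1 by (auto simp: Z_def regular_radius_def)
  have nonzero: "f z \<noteq> 0 \<and> f (z + \<eta>) \<noteq> 0 \<and> regular_radius (\<gamma> * r) \<and> regular_radius (\<gamma>\<^sup>2 * r)"
    if "cmod z = r" "r > 1" "r \<notin> Z" for z r
    using regular[OF that(2,3)] that(1) by (metis add_diff_cancel_right')
  show thesis
  \<comment> \<open>For constant \<open>f\<close> the characteristic may stay bounded, but the
    quotient is 1 and \<open>T >= 0\<close> suffices.\<close>
  proof (cases "\<exists>c. \<forall>z. f z = c")
    case True
    then obtain c where c: "\<And>z. f z = c" by blast
    show thesis
    proof (rule that[OF Z])
      fix z r assume z: "cmod z = r" "r > 1" "r \<notin> Z"
      note nz = nonzero[OF z]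
      have "nevanlinna_T (\<gamma> * r) f \<ge> 0"
        using nz z \<gamma>1 less_1_mult[of \<gamma> r] by (intro nevanlinna_T_bounds) auto
      then have "0 \<le> A * (nevanlinna_T (\<gamma> * r) f / r +
           real (zero_pole_count (\<gamma> * r) f) / r * (ln r) powr \<gamma> *
             log_plus (real (zero_pole_count (\<gamma> * r) f)))"
        using A0 z log_plus_nonneg by (intro mult_nonneg_nonneg add_nonneg_nonneg) auto
      moreover have "f (z + \<eta>) = f z" by (simp add: c)
      then have "ln (cmod (f (z + \<eta>) / f z)) = 0" using nz by simp
      ultimately show "f z \<noteq> 0 \<and> f (z + \<eta>) \<noteq> 0 \<and> regular_radius (\<gamma> * r) \<and> regular_radius (\<gamma>\<^sup>2 * r) \<and>
       \<bar>ln (cmod (f (z + \<eta>) / f z))\<bar> \<le>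
         A * (nevanlinna_T (\<gamma> * r) f / r +
           real (zero_pole_count (\<gamma> * r) f) / r * (ln r) powr \<gamma> *
             log_plus (real (zero_pole_count (\<gamma> * r) f)))"
        using nz by simp
    qed (auto simp: Z_def)
  next
    case False
    obtain K where K: "K \<ge> 0" "\<And>R. regular_radius R \<Longrightarrow> R \<ge> 1 \<Longrightarrow> mean_abs_log R \<le> 2 * nevanlinna_T R f + K"
      by (rule mean_abs_log_bound) blast
    obtain R1 where R1: "\<And>R. R \<ge> R1 \<Longrightarrow> regular_radius R \<Longrightarrow> max 1 K \<le> nevanlinna_T R f"
      using nevanlinna_T_unbounded[OF False, of "max 1 K"] unfolding eventually_at_top_linorder by blast
    obtain E r0 where E: "finite_log_measure E" "E \<subseteq> {1..}"
      "\<And>r. r \<ge> r0 \<Longrightarrow> r \<notin> E \<Longrightarrow>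
       close_sum \<eta> \<beta> r \<le> 4 / r + 2 * (real (zero_pole_count (\<gamma> * r) f) / r * (ln r) powr \<gamma> *
          log_plus (real (zero_pole_count (\<gamma> * r) f)))"
      by (rule close_sum_exceptional_set[OF \<beta> \<gamma>]) blast
    \<comment> \<open>In this order: the bound for \<open>close_sum\<close>,
      \<open>T >= max 1 K\<close>, \<open>ln r >= 1\<close>, and
      \<open>cmod \<eta> <= (\<beta> - 1) r / 2\<close>.\<close>
    define R0 where "R0 = Max {r0, R1, exp 1, 2 * cmod \<eta> / (\<beta> - 1)}"
    have R0: "r0 \<le> R0" "R1 \<le> R0" "exp 1 \<le> R0" "2 * cmod \<eta> / (\<beta> - 1) \<le> R0"
      by (auto simp: R0_def)
    show thesis
    proof (rule that[of "E \<union> Z \<union> {1..R0}"])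
      show "finite_log_measure (E \<union> Z \<union> {1..R0})"
        by (intro finite_log_measure_Un E Z finite_log_measure_bounded[of "{1..R0}" R0]) auto
      show "E \<union> Z \<union> {1..R0} \<subseteq> {1..}" using E(2) by (auto simp: Z_def)
      fix z r assume z: "cmod z = r" "r > 1" "r \<notin> E \<union> Z \<union> {1..R0}"
      then have r: "r > R0" "r \<notin> E" "r \<notin> Z" by auto
      note reg = regular[OF z(2) r(3)]
      define n T where "n = real (zero_pole_count (\<gamma> * r) f)" and "T = nevanlinna_T (\<gamma> * r) f"
      define Q where "Q = n / r * (ln r) powr \<gamma> * log_plus n"
      have "\<gamma> * r \<ge> r" using \<gamma>1 z by simp
      then have T: "T \<ge> 1" "T \<ge> K" using R1[of "\<gamma> * r"] reg r R0 by (auto simp: T_def)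
      have M: "mean_abs_log (\<gamma> * r) \<le> 3 * T"
        using K(2)[of "\<gamma> * r"] reg T \<open>\<gamma> * r \<ge> r\<close> z by (simp add: T_def)
      have l1: "ln r \<ge> 1" using r R0 z by (subst ln_ge_iff) auto
      have n0: "n \<ge> 0" by (simp add: n_def)
      have lp: "(ln r) powr \<gamma> \<ge> 1" using l1 \<gamma>1 by (intro ge_one_powr_ge_zero) auto
      have Q0: "Q \<ge> 0" using n0 z log_plus_nonneg by (simp add: Q_def)
      \<comment> \<open>The bare \<open>n / r\<close> fits under the main term if
        \<open>n >= 2\<close>, because then \<open>log_plus n >= 1/2\<close>. For
        \<open>n <= 1\<close> it is at most \<open>1 / r\<close>, which goes into
        \<open>T / r\<close>.\<close>
      have nb: "n / r \<le> 1 / r + 2 * Q"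
      proof (cases "n \<le> 1")
        case True
        then have "n / r \<le> 1 / r" using z by (intro divide_right_mono) auto
        then show ?thesis using Q0 by linarith
      next
        case False
        then have n2: "n \<ge> 2" by (simp add: n_def)
        have "1 / 2 \<le> ln (2::real)" using ln2_ge_two_thirds by simp
        also have "\<dots> \<le> ln n" using n2 by simp
        also have "\<dots> \<le> log_plus n" by (simp add: log_plus_def)
        finally have "1 \<le> 2 * log_plus n" by simp
        then have "1 * 1 \<le> (ln r) powr \<gamma> * (2 * log_plus n)" using lp by (intro mult_mono) auto
        then have "n / r * 1 \<le> n / r * ((ln r) powr \<gamma> * (2 * log_plus n))"
          using n0 z by (intro mult_left_mono) auto
        also have "\<dots> = 2 * Q" by (simp add: Q_def)
        finally have "n / r \<le> 2 * Q" by simp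
        moreover have "0 \<le> 1 / r" using z by simp
        ultimately show ?thesis by linarith
      qed
      have Tr: "1 / r \<le> T / r" using T z by (intro divide_right_mono) auto
      define c1 c2 where "c1 = 4 * \<gamma> / (\<gamma> - 1)\<^sup>2" and "c2 = 2 / (\<gamma> - 1) + 3 / (\<beta> - 1)"
      have c: "c1 \<ge> 0" "c2 \<ge> 0" using \<gamma>1 \<beta> by (auto simp: c1_def c2_def)
      have "\<bar>ln (cmod (f (z + \<eta>) / f z))\<bar> \<le> cmod \<eta> * (c1 * mean_abs_log (\<gamma> * r) / r + c2 * n / r + close_sum \<eta> \<beta> r)"
        unfolding c1_def c2_def n_def
      proof (rule log_shift_bound[OF \<beta> \<beta>\<gamma> z(1)])
        have "2 * cmod \<eta> / (\<beta> - 1) \<le> r" using r R0 by linarith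
        then show "cmod \<eta> \<le> (\<beta> - 1) * r / 2" using \<beta> by (simp add: field_simps)
      qed (use reg z in auto)
      also have "\<dots> \<le> cmod \<eta> * ((3 * c1 + 4 * c2 + 6) * (T / r + Q))"
      proof (rule mult_left_mono)
        define u where "u = T / r"
        have "c1 * mean_abs_log (\<gamma> * r) / r \<le> c1 * (3 * T) / r"
          using M c z by (intro divide_right_mono mult_left_mono) auto
        then have 1: "c1 * mean_abs_log (\<gamma> * r) / r \<le> 3 * (c1 * u)" by (simp add: u_def mult_ac)
        have "c2 * (n / r) \<le> c2 * (u + 2 * Q)"
          using nb Tr c by (intro mult_left_mono) (auto simp: u_def)
        then have 2: "c2 * n / r \<le> c2 * u + 2 * (c2 * Q)" by (simp add: distrib_left mult_ac)
        have 3: "close_sum \<eta> \<beta> r \<le> 4 * u + 2 * Q"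
          using E(3)[of r] r R0 Tr unfolding Q_def n_def u_def by simp
        have "0 \<le> c1 * Q" "0 \<le> c2 * Q" "0 \<le> c2 * u" "0 \<le> u"
          using c Q0 T z by (auto simp: u_def)
        moreover have "(3 * c1 + 4 * c2 + 6) * (u + Q) =
            3 * (c1 * u) + 4 * (c2 * u) + 6 * u + 3 * (c1 * Q) + 4 * (c2 * Q) + 6 * Q"
          by (simp add: algebra_simps)
        ultimately show "c1 * mean_abs_log (\<gamma> * r) / r + c2 * n / r + close_sum \<eta> \<beta> r \<le>
            (3 * c1 + 4 * c2 + 6) * (T / r + Q)"
          using 1 2 3 Q0 unfolding u_def[symmetric] by linarith
      qed simp
      also have "\<dots> = A * (T / r + Q)" by (simp add: A_def c1_def c2_def)
      finally show "f z \<noteq> 0 \<and> f (z + \<eta>) \<noteq> 0 \<and> regular_radius (\<gamma> * r) \<and> regular_radius (\<gamma>\<^sup>2 * r) \<and>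
       \<bar>ln (cmod (f (z + \<eta>) / f z))\<bar> \<le>
         A * (nevanlinna_T (\<gamma> * r) f / r +
           real (zero_pole_count (\<gamma> * r) f) / r * (ln r) powr \<gamma> *
             log_plus (real (zero_pole_count (\<gamma> * r) f)))"
        using nonzero[OF z(1,2) r(3)] by (simp add: T_def Q_def n_def)
    qed
  qed
qed

section \<open>Functions of finite order\<close>

lemma growth_order_nonneg: "growth_order f \<ge> 0"
  unfolding growth_order_def
proof (rule le_Limsup)
  show "\<forall>\<^sub>F r in at_top. 0 \<le> ereal (log_plus (nevanlinna_T r f) / ln r)"
    using eventually_gt_at_top[of 1] by eventually_elim (simp add: log_plus_nonneg)
qed simp

lemma nevanlinna_T_growth:
  assumes "growth_order f = ereal \<sigma>" "\<sigma> < s"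
  shows "eventually (\<lambda>r. nevanlinna_T r f \<le> r powr s) at_top"
proof -
  have "Limsup at_top (\<lambda>r::real. ereal (log_plus (nevanlinna_T r f) / ln r)) < ereal s"
    using assms by (simp add: growth_order_def)
  then have "eventually (\<lambda>r. ereal (log_plus (nevanlinna_T r f) / ln r) < ereal s) at_top"
    by (rule Limsup_lessD)
  then show ?thesis using eventually_gt_at_top[of 1]
  proof eventually_elim
    case (elim r)
    show ?case
    proof (cases "nevanlinna_T r f > 0")
      case True
      have "ln (nevanlinna_T r f) \<le> log_plus (nevanlinna_T r f)" by (simp add: log_plus_def)
      also have "\<dots> \<le> s * ln r" using elim by (simp add: field_simps)
      finally have "nevanlinna_T r f \<le> exp (s * ln r)" using True by (metis exp_le_cancel_iff exp_ln)
      then show ?thesis using elim by (simp add: powr_def)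
    next
      case False
      then show ?thesis by (meson not_less order_trans powr_ge_zero)
    qed
  qed
qed

text \<open>Comparing counts at \<open>\<gamma> r\<close> with integrated counts at
  \<open>\<gamma>^2 r\<close> costs a factor \<open>ln \<gamma>\<close> and gives
  \<open>n(\<gamma> r) = O(r^s)\<close>. Regularity enters only at \<open>\<gamma>^2 r\<close>,
  through Jensen's formula; the bounds on \<open>T\<close> from the order hold at all large
  radii.\<close>

lemma finite_order_majorant:
  assumes \<sigma>: "growth_order f = ereal \<sigma>" and \<gamma>: "\<gamma> > 1" and \<epsilon>: "\<epsilon> > 0" and A: "A \<ge> 0"
  shows "eventually (\<lambda>r. regular_radius (\<gamma>\<^sup>2 * r) \<longrightarrow>
    A * (nevanlinna_T (\<gamma> * r) f / r +
           real (zero_pole_count (\<gamma> * r) f) / r * (ln r) powr \<gamma> *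
             log_plus (real (zero_pole_count (\<gamma> * r) f))) \<le> r powr (\<sigma> - 1 + \<epsilon>)) at_top"
proof -
  have \<sigma>0: "\<sigma> \<ge> 0" using growth_order_nonneg \<sigma> by simp
  \<comment> \<open>Half of \<open>\<epsilon>\<close> goes to the definition of the order, the other
    half beats the logarithms and constants.\<close>
  define s where "s = \<sigma> + \<epsilon> / 2"
  have s: "s > 0" "\<sigma> < s" "s < \<sigma> + \<epsilon>" using \<sigma>0 \<epsilon> by (auto simp: s_def)
  obtain K where K: "K \<ge> 0"
    "\<And>R. regular_radius R \<Longrightarrow> R \<ge> 1 \<Longrightarrow> zero_integrated_count R \<le> nevanlinna_T R f + K"
    by (rule mean_abs_log_bound) blast
  define b where "b = (\<lambda>r. (2 * (\<gamma>\<^sup>2 * r) powr s + K) / ln \<gamma>)"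
  have lg: "ln \<gamma> > 0" using \<gamma> by simp
  have "filterlim (\<lambda>r. \<gamma> * r) at_top at_top" "filterlim (\<lambda>r. \<gamma>\<^sup>2 * r) at_top at_top"
    using \<gamma> by (auto intro!: filterlim_tendsto_pos_mult_at_top[OF tendsto_const] filterlim_ident)
  then have T: "eventually (\<lambda>r. nevanlinna_T (\<gamma> * r) f \<le> (\<gamma> * r) powr s) at_top"
      "eventually (\<lambda>r. nevanlinna_T (\<gamma>\<^sup>2 * r) f \<le> (\<gamma>\<^sup>2 * r) powr s) at_top"
    using nevanlinna_T_growth[OF \<sigma> s(2)] by (auto elim: eventually_compose_filterlim)
  \<comment> \<open>\<open>ln (1 + b r)\<close> replaces \<open>log_plus n\<close> as a majorant
    that also covers \<open>n = 0\<close>, where \<open>log_plus 0 = 0\<close>.\<close>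
  have as: "eventually (\<lambda>r. A * ((\<gamma> * r) powr s / r + b r / r * (ln r) powr \<gamma> * ln (1 + b r)) \<le> r powr (\<sigma> + \<epsilon> - 1)) at_top"
    unfolding b_def using s \<gamma> lg A K(1) by real_asymp
  show ?thesis
    using T as eventually_ge_at_top[of 1]
  proof eventually_elim
    case (elim r)
    show ?case
    proof
      assume reg: "regular_radius (\<gamma>\<^sup>2 * r)"
      define n where "n = real (zero_pole_count (\<gamma> * r) f)"
      have r1: "\<gamma> * r \<ge> 1" "\<gamma>\<^sup>2 * r \<ge> 1" using elim \<gamma> by (smt (verit) mult_le_cancel_right1 one_less_power zero_less_numeral)+
      have "n * ln \<gamma> = n * ln (\<gamma>\<^sup>2 * r / (\<gamma> * r))" using \<gamma> elim by (simp add: power2_eq_square)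
      also have "\<dots> \<le> zero_integrated_count (\<gamma>\<^sup>2 * r) + integrated_count (\<gamma>\<^sup>2 * r) f"
        unfolding n_def using r1 \<gamma> elim by (intro zero_pole_count_le_integrated) (auto simp: power2_eq_square)
      also have "\<dots> \<le> 2 * nevanlinna_T (\<gamma>\<^sup>2 * r) f + K"
        using K(2)[OF reg r1(2)] nevanlinna_T_bounds(2)[OF reg r1(2)] by simp
      also have "\<dots> \<le> 2 * (\<gamma>\<^sup>2 * r) powr s + K" using elim by simp
      finally have nb: "n \<le> b r" using lg by (simp add: b_def field_simps)
      have n0: "n \<ge> 0" by (simp add: n_def)
      have "log_plus n \<le> ln (1 + b r)"
        using nb n0 unfolding log_plus_def by (cases "n = 0") (auto intro!: ln_mono)
      then have "n / r * (ln r) powr \<gamma> * log_plus n \<le> b r / r * (ln r) powr \<gamma> * ln (1 + b r)"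
        using nb n0 elim log_plus_nonneg by (intro mult_mono divide_right_mono) auto
      moreover have "nevanlinna_T (\<gamma> * r) f / r \<le> (\<gamma> * r) powr s / r"
        using elim by (intro divide_right_mono) auto
      ultimately have "A * (nevanlinna_T (\<gamma> * r) f / r + n / r * (ln r) powr \<gamma> * log_plus n)
         \<le> A * ((\<gamma> * r) powr s / r + b r / r * (ln r) powr \<gamma> * ln (1 + b r))"
        using A by (intro mult_left_mono add_mono)
      also have "\<dots> \<le> r powr (\<sigma> + \<epsilon> - 1)" by (rule elim)
      also have "\<sigma> + \<epsilon> - 1 = \<sigma> - 1 + \<epsilon>" by simp
      finally show "A * (nevanlinna_T (\<gamma> * r) f / r +
           real (zero_pole_count (\<gamma> * r) f) / r * (ln r) powr \<gamma> *
             log_plus (real (zero_pole_count (\<gamma> * r) f))) \<le> r powr (\<sigma> - 1 + \<epsilon>)" by (simp only: n_def)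
    qed
  qed
qed

end

theorem theorem8p2:
  fixes \<eta> :: complex and \<gamma> :: real
  assumes "\<eta> \<noteq> 0" and "\<gamma> > 1"
  shows "\<exists>A::real. \<forall>(f :: complex \<Rightarrow> complex) (\<epsilon>::real).
    f nicely_meromorphic_on UNIV \<longrightarrow> f \<noteq> (\<lambda>_. 0) \<longrightarrow> \<epsilon> > 0 \<longrightarrow>
    (\<exists>E \<subseteq> {1<..}. finite_log_measure E \<and>
      (\<forall>z r. cmod z = r \<longrightarrow> r \<notin> E \<union> {0..1} \<longrightarrow>
         f z \<noteq> 0 \<and> f (z + \<eta>) \<noteq> 0 \<and>
         \<bar>ln (cmod (f (z + \<eta>) / f z))\<bar> \<le>
           A * (nevanlinna_T (\<gamma> * r) f / r +
                real (zero_pole_count (\<gamma> * r) f) / r * (ln r) powr \<gamma> *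
                  log_plus (real (zero_pole_count (\<gamma> * r) f)))) \<and>
      (\<forall>\<sigma>::real. growth_order f = ereal \<sigma> \<longrightarrow>
        (\<forall>z r. cmod z = r \<longrightarrow> r \<notin> E \<union> {0..1} \<longrightarrow>
           exp (- (r powr (\<sigma> - 1 + \<epsilon>))) \<le> cmod (f (z + \<eta>) / f z) \<and>
           cmod (f (z + \<eta>) / f z) \<le> exp (r powr (\<sigma> - 1 + \<epsilon>)))))"
proof -
  define \<beta> where "\<beta> = sqrt \<gamma>"
  have \<beta>: "\<beta> > 1" "\<gamma> = \<beta>\<^sup>2" using assms by (auto simp: \<beta>_def)
  define A where "A = cmod \<eta> * (12 * \<gamma> / (\<gamma> - 1)\<^sup>2 + 4 * (2 / (\<gamma> - 1) + 3 / (\<beta> - 1)) + 6)"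
  have A0: "A \<ge> 0" using \<beta>(1) assms by (simp add: A_def)
  show ?thesis
  proof (intro exI[of _ A] allI impI)
    fix f :: "complex \<Rightarrow> complex" and \<epsilon> :: real
    assume f: "f nicely_meromorphic_on UNIV" "f \<noteq> (\<lambda>_. 0)" and \<epsilon>: "\<epsilon> > 0"
    interpret plane_meromorphic f by unfold_locales (fact f)+
    define B where "B r = A * (nevanlinna_T (\<gamma> * r) f / r +
                real (zero_pole_count (\<gamma> * r) f) / r * (ln r) powr \<gamma> *
                  log_plus (real (zero_pole_count (\<gamma> * r) f)))" for r
    obtain E0 where E0: "finite_log_measure E0" "E0 \<subseteq> {1..}"
      "\<And>z r. cmod z = r \<Longrightarrow> r > 1 \<Longrightarrow> r \<notin> E0 \<Longrightarrow>
         f z \<noteq> 0 \<and> f (z + \<eta>) \<noteq> 0 \<and> regular_radius (\<gamma> * r) \<and> regular_radius (\<gamma>\<^sup>2 * r) \<and>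
         \<bar>ln (cmod (f (z + \<eta>) / f z))\<bar> \<le> B r"
      unfolding B_def A_def by (rule log_shift_estimate[OF \<beta>, of \<eta>]) blast
    \<comment> \<open>\<open>R0\<close> has to be chosen before \<open>\<sigma>\<close>. This is
      possible as the order determines \<open>\<sigma>\<close>; for infinite order the claim is
      vacuous.\<close>
    obtain R0 where R0: "\<And>\<sigma> r. growth_order f = ereal \<sigma> \<Longrightarrow> r \<ge> R0 \<Longrightarrow> regular_radius (\<gamma>\<^sup>2 * r) \<Longrightarrow>
        B r \<le> r powr (\<sigma> - 1 + \<epsilon>)"
    proof (cases "\<exists>\<sigma>. growth_order f = ereal \<sigma>")
      case True
      then obtain \<sigma> where \<sigma>: "growth_order f = ereal \<sigma>" by blast
      show thesis
        using finite_order_majorant[OF \<sigma> assms(2) \<epsilon> A0] that \<sigma>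
        unfolding eventually_at_top_linorder B_def by auto
    qed auto
    \<comment> \<open>Adding the radii up to \<open>R0\<close> makes (b) hold for all
      \<open>r\<close> outside \<open>E\<close> and not only for large ones. Only this part of
      \<open>E\<close> depends on \<open>\<epsilon>\<close>.\<close>
    define E where "E = {1<..} \<inter> (E0 \<union> {1..R0})"
    show "\<exists>E \<subseteq> {1<..}. finite_log_measure E \<and>
      (\<forall>z r. cmod z = r \<longrightarrow> r \<notin> E \<union> {0..1} \<longrightarrow>
         f z \<noteq> 0 \<and> f (z + \<eta>) \<noteq> 0 \<and>
         \<bar>ln (cmod (f (z + \<eta>) / f z))\<bar> \<le>
           A * (nevanlinna_T (\<gamma> * r) f / r +
                real (zero_pole_count (\<gamma> * r) f) / r * (ln r) powr \<gamma> *
                  log_plus (real (zero_pole_count (\<gamma> * r) f)))) \<and>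
      (\<forall>\<sigma>::real. growth_order f = ereal \<sigma> \<longrightarrow>
        (\<forall>z r. cmod z = r \<longrightarrow> r \<notin> E \<union> {0..1} \<longrightarrow>
           exp (- (r powr (\<sigma> - 1 + \<epsilon>))) \<le> cmod (f (z + \<eta>) / f z) \<and>
           cmod (f (z + \<eta>) / f z) \<le> exp (r powr (\<sigma> - 1 + \<epsilon>))))"
      unfolding B_def[symmetric]
    proof (intro exI[of _ E] conjI allI impI)
      show "E \<subseteq> {1<..}" by (auto simp: E_def)
      have F: "finite_log_measure (E0 \<union> {1..R0})"
        by (intro finite_log_measure_Un E0 finite_log_measure_bounded[of _ R0]) auto
      show "finite_log_measure E" unfolding E_def by (rule finite_log_measure_subset[OF F]) (use F in \<open>auto simp: finite_log_measure_def\<close>)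
    next
      fix z r assume z: "cmod z = r" "r \<notin> E \<union> {0..1}"
      then have r: "r > 1" "r \<notin> E0" using norm_ge_zero[of z] by (auto simp: E_def)
      show "f z \<noteq> 0" "f (z + \<eta>) \<noteq> 0" "\<bar>ln (cmod (f (z + \<eta>) / f z))\<bar> \<le> B r"
        using E0(3)[OF z(1) r] by auto
    next
      fix \<sigma> z r assume \<sigma>: "growth_order f = ereal \<sigma>" and z: "cmod z = r" "r \<notin> E \<union> {0..1}"
      then have r: "r > 1" "r \<notin> E0" "r \<ge> R0" using norm_ge_zero[of z] by (auto simp: E_def)
      note e = E0(3)[OF z(1) r(1,2)]
      have "\<bar>ln (cmod (f (z + \<eta>) / f z))\<bar> \<le> r powr (\<sigma> - 1 + \<epsilon>)"
        using e R0[OF \<sigma> r(3)] by linarith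
      then have l: "- (r powr (\<sigma> - 1 + \<epsilon>)) \<le> ln (cmod (f (z + \<eta>) / f z))"
          "ln (cmod (f (z + \<eta>) / f z)) \<le> r powr (\<sigma> - 1 + \<epsilon>)" by linarith+
      have pos: "cmod (f (z + \<eta>) / f z) > 0" using e by simp
      show "exp (- (r powr (\<sigma> - 1 + \<epsilon>))) \<le> cmod (f (z + \<eta>) / f z)"
        using l(1) pos by (subst (asm) ln_ge_iff) auto
      show "cmod (f (z + \<eta>) / f z) \<le> exp (r powr (\<sigma> - 1 + \<epsilon>))"
        using l(2) pos by (metis exp_le_cancel_iff exp_ln)
    qed
  qed
qed

end
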